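(* Let $\mathcal{C}$ be an absolute (concrete) category which supports elementary embeddings, and let $(L,\eta)$ be an absolute extremal epireflection on $\mathcal{C}$. If there is a supercompact cardinal $\kappa$ greater than the ranks of the parameters in the definition of $\mathcal{C}$ and in the definition of the class of $L$-local objects, then there is a set $\mathcal{F}$ of morphisms of $\mathcal{C}$ such that $L$ is an $\mathcal{F}$-localization.
   Context: We work in ZFC; $V$ is the universe of all sets and $V_\alpha$ its cumulative hierarchy; $\mathrm{rank}(x)$ is the least $\alpha$ with $x\in V_{\alpha+1}$. Set theory. An inner model is a transitive proper class containing all ordinals and satisfying ZFC. A formula $\varphi$ of the language of set theory is absolute with respect to parameters $a_1,\dots,a_n$ if, for every inner model $M$ containing $a_1,\dots,a_n$ and all values in $M$ of the remaining free variables, $\varphi$ (with parameters $a_1,\dots,a_n$) is satisfied in $M$ if and only if it is satisfied in $V$. A set or class is absolute if it is defined in $V$ by an absolute formula with parameters. An elementary embedding $j\colon V\to M$ is one preserving and reflecting the truth of all formulas; here $M$ is an inner model. A cardinal $\kappa$ is $\lambda$-supercompact ($\lambda$ an ordinal) if there is a normal measure on $\mathcal{P}_\kappa(\lambda)$; equivalently, if there is an elementary embedding $j\colon V\to M$ into an inner model $M$ with $j(\alpha)=\alpha$ for all $\alpha<\kappa$, $j(\kappa)>\lambda$, and every function $\lambda\to M$ an element of $M$. It is supercompact if it is $\lambda$-supercompact for every ordinal $\lambda$. Categories. Hom-classes $\mathcal{C}(X,Y)$ are sets. A concrete category is a category with a faithful functor to sets; the functor is omitted from the notation, so objects are identified with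 their underlying sets and morphisms with functions. A concrete category $\mathcal{C}$ is absolute if there is a formula $\varphi(x,y,z,x_1,\dots,x_n)$, absolute with respect to parameters $a_1,\dots,a_n$, such that for all sets $A,B$ and every function $f\colon A\to B$, $\varphi(A,B,f,a_1,\dots,a_n)$ holds in $V$ if and only if $A$ and $B$ are objects of $\mathcal{C}$ and $f\in\mathcal{C}(A,B)$. A concrete category $\mathcal{C}$ supports elementary embeddings if, for every elementary embedding $j\colon V\to M$ and every object $X$ of $\mathcal{C}$, the restriction $j\restriction X\colon X\to j(X)$, $x\mapsto j(x)$, underlies a morphism of $\mathcal{C}$. Reflections. A reflection on $\mathcal{C}$ is a pair $(L,\eta)$ with $L\colon\mathcal{C}\to\mathcal{C}$ a functor and $\eta\colon\mathrm{Id}\to L$ a natural transformation such that $\eta_{LX}$ is an isomorphism and $\eta_{LX}=L\eta_X$ for all $X$. An object $X$ is $L$-local if $\eta_X$ is an isomorphism. An epimorphism $e$ is extremal if whenever $e=m\circ v$ with $m$ a monomorphism, $m$ is an isomorphism. $L$ is an extremal epireflection if every $\eta_X$ is an extremal epimorphism. $L$ is absolute if the class of $L$-local objects is absolute. An object $X$ is orthogonal to $f\colon A\to B$ if for every $g\colon A\to X$ there is a unique $g'\colon B\to X$ with $g'\circ f=g$. $L$ is an $\mathcal{F}$-localization, for a set $\mathcal{F}$ of morphisms, if the $L$-local objects are exactly the objects orthogonal to all morphisms in $\mathcal{F}$. *)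

theory Defs
  imports Main
begin

text \<open>
  HOL is the metatheory. The universe V of all sets is an arbitrary model of first-order ZFC: a
  type with a binary relation satisfying the ZFC axioms, the two schemes being indexed by (deeply
  embedded) formulas. Classes are, as always in ZFC, the collections that are first-order definable
  over V with parameters; in particular inner models, elementary embeddings, categories and functors
  are definable classes.
\<close>

section \<open>Formulas, satisfaction, and ZFC\<close>

text \<open>Formulas with named variables; quantification over a variable rebinds its value.\<close>

datatype fm =
    FMem nat nat
  | FEq nat nat
  | FNeg fm
  | FAnd fm fm
  | FAll nat fm

primrec fv :: "fm \<Rightarrow> nat set" where
  "fv (FMem i k) = {i, k}"
| "fv (FEq i k) = {i, k}"
| "fv (FNeg p) = fv p"
| "fv (FAnd p q) = fv p \<union> fv q"
| "fv (FAll i p) = fv p - {i}"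

class membership =
  fixes mem :: "'a \<Rightarrow> 'a \<Rightarrow> bool"  (infix \<open>\<in>\<^sub>V\<close> 50)

primrec (in membership) sat :: "'a set \<Rightarrow> fm \<Rightarrow> (nat \<Rightarrow> 'a) \<Rightarrow> bool" where
  "sat M (FMem i k) v \<longleftrightarrow> v i \<in>\<^sub>V v k"
| "sat M (FEq i k) v \<longleftrightarrow> v i = v k"
| "sat M (FNeg p) v \<longleftrightarrow> \<not> sat M p v"
| "sat M (FAnd p q) v \<longleftrightarrow> sat M p v \<and> sat M q v"
| "sat M (FAll i p) v \<longleftrightarrow> (\<forall>x\<in>M. sat M p (v(i := x)))"

text \<open>
  The structure with domain \<open>M\<close> and the relation of V satisfies ZFC. The conjuncts are
  Extensionality, Foundation, Pairing, Union, Power Set, Infinity, Choice (every family of nonempty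
  pairwise disjoint sets has a transversal), and the Separation and Replacement schemes.
\<close>

definition (in membership) zfc_model :: "'a set \<Rightarrow> bool" where
  "zfc_model M \<longleftrightarrow>
     (\<forall>x\<in>M. \<forall>y\<in>M. (\<forall>z\<in>M. z \<in>\<^sub>V x \<longleftrightarrow> z \<in>\<^sub>V y) \<longrightarrow> x = y) \<and>
     (\<forall>x\<in>M. (\<exists>y\<in>M. y \<in>\<^sub>V x) \<longrightarrow> (\<exists>y\<in>M. y \<in>\<^sub>V x \<and> \<not> (\<exists>z\<in>M. z \<in>\<^sub>V x \<and> z \<in>\<^sub>V y))) \<and>
     (\<forall>x\<in>M. \<forall>y\<in>M. \<exists>p\<in>M. \<forall>z\<in>M. z \<in>\<^sub>V p \<longleftrightarrow> z = x \<or> z = y) \<and>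
     (\<forall>x\<in>M. \<exists>u\<in>M. \<forall>z\<in>M. z \<in>\<^sub>V u \<longleftrightarrow> (\<exists>y\<in>M. z \<in>\<^sub>V y \<and> y \<in>\<^sub>V x)) \<and>
     (\<forall>x\<in>M. \<exists>p\<in>M. \<forall>z\<in>M. z \<in>\<^sub>V p \<longleftrightarrow> (\<forall>w\<in>M. w \<in>\<^sub>V z \<longrightarrow> w \<in>\<^sub>V x)) \<and>
     (\<exists>x\<in>M. (\<exists>e\<in>M. e \<in>\<^sub>V x \<and> (\<forall>z\<in>M. \<not> z \<in>\<^sub>V e)) \<and>
        (\<forall>y\<in>M. y \<in>\<^sub>V x \<longrightarrow> (\<exists>s\<in>M. s \<in>\<^sub>V x \<and> (\<forall>z\<in>M. z \<in>\<^sub>V s \<longleftrightarrow> z \<in>\<^sub>V y \<or> z = y)))) \<and>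
     (\<forall>x\<in>M. (\<forall>y\<in>M. y \<in>\<^sub>V x \<longrightarrow> (\<exists>z\<in>M. z \<in>\<^sub>V y)) \<and>
        (\<forall>y\<in>M. \<forall>y'\<in>M. y \<in>\<^sub>V x \<and> y' \<in>\<^sub>V x \<and> y \<noteq> y' \<longrightarrow> \<not> (\<exists>z\<in>M. z \<in>\<^sub>V y \<and> z \<in>\<^sub>V y')) \<longrightarrow>
        (\<exists>c\<in>M. \<forall>y\<in>M. y \<in>\<^sub>V x \<longrightarrow> (\<exists>!z. z \<in> M \<and> z \<in>\<^sub>V y \<and> z \<in>\<^sub>V c))) \<and>
     (\<forall>\<phi> v. range v \<subseteq> M \<longrightarrow>
        (\<forall>a\<in>M. \<exists>s\<in>M. \<forall>x\<in>M. x \<in>\<^sub>V s \<longleftrightarrow> x \<in>\<^sub>V a \<and> sat M \<phi> (v(0 := x)))) \<and>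
     (\<forall>\<phi> v. range v \<subseteq> M \<longrightarrow>
        (\<forall>a\<in>M.
          (\<forall>x\<in>M. \<forall>y\<in>M. \<forall>y'\<in>M. x \<in>\<^sub>V a \<and> sat M \<phi> (v(0 := x, 1 := y)) \<and>
              sat M \<phi> (v(0 := x, 1 := y')) \<longrightarrow> y = y') \<longrightarrow>
          (\<exists>s\<in>M. \<forall>y\<in>M. y \<in>\<^sub>V s \<longleftrightarrow> (\<exists>x\<in>M. x \<in>\<^sub>V a \<and> sat M \<phi> (v(0 := x, 1 := y))))))"

class zfc = membership +
  assumes zfc_UNIV: "zfc_model UNIV"

text \<open>
  \<open>holds M \<phi> xs\<close>: \<open>\<phi>\<close> is satisfied in \<open>M\<close> when variable \<open>i\<close> has value \<open>xs ! i\<close>; it is only used when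
  the free variables of \<open>\<phi>\<close> are below \<open>length xs\<close>.
\<close>

definition holds :: "'v::membership set \<Rightarrow> fm \<Rightarrow> 'v list \<Rightarrow> bool" where
  "holds M \<phi> xs \<longleftrightarrow> sat M \<phi> (\<lambda>i. xs ! i)"

text \<open>Definable (with parameters) classes of \<open>n\<close>-tuples, the tuples being represented as lists.\<close>

definition definable :: "nat \<Rightarrow> 'v::membership list set \<Rightarrow> bool" where
  "definable n S \<longleftrightarrow> (\<exists>\<phi> ps. fv \<phi> \<subseteq> {..<n + length ps} \<and>
     S = {xs. length xs = n \<and> holds UNIV \<phi> (xs @ ps)})"

section \<open>Sets inside V\<close>

definition the_set :: "('v::zfc \<Rightarrow> bool) \<Rightarrow> 'v" where
  "the_set P = (THE s. \<forall>x. x \<in>\<^sub>V s \<longleftrightarrow> P x)"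

definition vsubset :: "'v::zfc \<Rightarrow> 'v \<Rightarrow> bool" where
  "vsubset x y \<longleftrightarrow> (\<forall>z. z \<in>\<^sub>V x \<longrightarrow> z \<in>\<^sub>V y)"

definition upair :: "'v::zfc \<Rightarrow> 'v \<Rightarrow> 'v" where
  "upair a b = the_set (\<lambda>z. z = a \<or> z = b)"

definition opair :: "'v::zfc \<Rightarrow> 'v \<Rightarrow> 'v" where
  "opair a b = upair (upair a a) (upair a b)"

definition is_fun :: "'v::zfc \<Rightarrow> 'v \<Rightarrow> 'v \<Rightarrow> bool" where
  "is_fun f A B \<longleftrightarrow>
     (\<forall>p. p \<in>\<^sub>V f \<longrightarrow> (\<exists>a b. a \<in>\<^sub>V A \<and> b \<in>\<^sub>V B \<and> p = opair a b)) \<and>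
     (\<forall>a. a \<in>\<^sub>V A \<longrightarrow> (\<exists>!b. opair a b \<in>\<^sub>V f))"

definition is_bij :: "'v::zfc \<Rightarrow> 'v \<Rightarrow> 'v \<Rightarrow> bool" where
  "is_bij f A B \<longleftrightarrow> is_fun f A B \<and> (\<forall>b. b \<in>\<^sub>V B \<longrightarrow> (\<exists>!a. opair a b \<in>\<^sub>V f))"

definition vid :: "'v::zfc \<Rightarrow> 'v" where
  "vid A = the_set (\<lambda>p. \<exists>a. a \<in>\<^sub>V A \<and> p = opair a a)"

definition vcomp :: "'v::zfc \<Rightarrow> 'v \<Rightarrow> 'v"  (infixl \<open>\<circ>\<^sub>V\<close> 70) where
  "g \<circ>\<^sub>V f = the_set (\<lambda>p. \<exists>a b c. opair a b \<in>\<^sub>V f \<and> opair b c \<in>\<^sub>V g \<and> p = opair a c)"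

definition restr :: "('v::zfc \<Rightarrow> 'v) \<Rightarrow> 'v \<Rightarrow> 'v" where
  "restr j X = the_set (\<lambda>p. \<exists>x. x \<in>\<^sub>V X \<and> p = opair x (j x))"

definition transitive_set :: "'v::zfc \<Rightarrow> bool" where
  "transitive_set x \<longleftrightarrow> (\<forall>y z. y \<in>\<^sub>V x \<longrightarrow> z \<in>\<^sub>V y \<longrightarrow> z \<in>\<^sub>V x)"

text \<open>Well-foundedness of ordinals under membership comes for free from Foundation.\<close>

definition Ord :: "'v::zfc \<Rightarrow> bool" where
  "Ord \<alpha> \<longleftrightarrow> transitive_set \<alpha> \<and> (\<forall>x y. x \<in>\<^sub>V \<alpha> \<longrightarrow> y \<in>\<^sub>V \<alpha> \<longrightarrow> x \<in>\<^sub>V y \<or> x = y \<or> y \<in>\<^sub>V x)"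

definition Card :: "'v::zfc \<Rightarrow> bool" where
  "Card \<kappa> \<longleftrightarrow> Ord \<kappa> \<and> \<not> (\<exists>\<alpha> f. \<alpha> \<in>\<^sub>V \<kappa> \<and> is_bij f \<alpha> \<kappa>)"

definition vsucc :: "'v::zfc \<Rightarrow> 'v" where
  "vsucc \<alpha> = the_set (\<lambda>x. x \<in>\<^sub>V \<alpha> \<or> x = \<alpha>)"

text \<open>
  The cumulative hierarchy for an ordinal \<open>\<alpha>\<close>: the value at \<open>\<alpha>\<close> of the function \<open>f\<close> on \<open>\<alpha> + 1\<close> whose
  value at each \<open>\<beta>\<close> is the union of the power sets of its values at the ordinals below \<open>\<beta>\<close>. The
  recursion has to be carried out inside V, since the ordinals of V need not be well-founded in HOL.
\<close>

definition Vset :: "'v::zfc \<Rightarrow> 'v" where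
  "Vset \<alpha> = (THE v. \<exists>f B. is_fun f (vsucc \<alpha>) B \<and>
     (\<forall>\<beta> u. opair \<beta> u \<in>\<^sub>V f \<longrightarrow>
        (\<forall>x. x \<in>\<^sub>V u \<longleftrightarrow> (\<exists>\<gamma> w. \<gamma> \<in>\<^sub>V \<beta> \<and> opair \<gamma> w \<in>\<^sub>V f \<and> vsubset x w))) \<and>
     opair \<alpha> v \<in>\<^sub>V f)"

definition rank :: "'v::zfc \<Rightarrow> 'v" where
  "rank x = (THE \<alpha>. Ord \<alpha> \<and> x \<in>\<^sub>V Vset (vsucc \<alpha>) \<and>
     (\<forall>\<beta>. Ord \<beta> \<longrightarrow> x \<in>\<^sub>V Vset (vsucc \<beta>) \<longrightarrow> \<beta> = \<alpha> \<or> \<alpha> \<in>\<^sub>V \<beta>))"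

section \<open>Inner models, absoluteness, elementary embeddings, supercompactness\<close>

definition inner_model :: "'v::zfc set \<Rightarrow> bool" where
  "inner_model M \<longleftrightarrow>
     definable 1 {[x] |x. x \<in> M} \<and>
     (\<forall>x y. x \<in> M \<longrightarrow> y \<in>\<^sub>V x \<longrightarrow> y \<in> M) \<and>
     \<not> (\<exists>s. \<forall>x. x \<in>\<^sub>V s \<longleftrightarrow> x \<in> M) \<and>
     (\<forall>\<alpha>. Ord \<alpha> \<longrightarrow> \<alpha> \<in> M) \<and>
     zfc_model M"

text \<open>
  \<open>absolute \<phi> n ps\<close>: the formula \<open>\<phi>\<close>, whose variables below \<open>n\<close> are left free and whose next
  \<open>length ps\<close> variables are interpreted by the parameters \<open>ps\<close>, is absolute with respect to \<open>ps\<close>.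
\<close>

definition absolute :: "fm \<Rightarrow> nat \<Rightarrow> 'v::zfc list \<Rightarrow> bool" where
  "absolute \<phi> n ps \<longleftrightarrow> fv \<phi> \<subseteq> {..<n + length ps} \<and>
     (\<forall>M xs. inner_model M \<longrightarrow> set ps \<subseteq> M \<longrightarrow> length xs = n \<longrightarrow> set xs \<subseteq> M \<longrightarrow>
        (holds M \<phi> (xs @ ps) \<longleftrightarrow> holds UNIV \<phi> (xs @ ps)))"

definition elementary_embedding :: "('v::zfc \<Rightarrow> 'v) \<Rightarrow> 'v set \<Rightarrow> bool" where
  "elementary_embedding j M \<longleftrightarrow>
     inner_model M \<and>
     definable 2 {[x, j x] |x. True} \<and>
     range j \<subseteq> M \<and>
     (\<forall>\<phi> v. sat UNIV \<phi> v \<longleftrightarrow> sat M \<phi> (j \<circ> v))"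

definition supercompact_for :: "'v::zfc \<Rightarrow> 'v \<Rightarrow> bool" where
  "supercompact_for \<mu> \<kappa> \<longleftrightarrow> Card \<kappa> \<and>
     (\<exists>j M. elementary_embedding j M \<and>
        (\<forall>\<alpha>. \<alpha> \<in>\<^sub>V \<kappa> \<longrightarrow> j \<alpha> = \<alpha>) \<and>
        \<mu> \<in>\<^sub>V j \<kappa> \<and>
        (\<forall>f B. is_fun f \<mu> B \<and> (\<forall>a b. opair a b \<in>\<^sub>V f \<longrightarrow> b \<in> M) \<longrightarrow> f \<in> M))"

definition supercompact :: "'v::zfc \<Rightarrow> bool" where
  "supercompact \<kappa> \<longleftrightarrow> Card \<kappa> \<and> (\<forall>\<mu>. Ord \<mu> \<longrightarrow> supercompact_for \<mu> \<kappa>)"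

section \<open>Concrete categories\<close>

text \<open>
  Objects are identified with their underlying sets and morphisms with functions. As a function does
  not determine its codomain, a morphism is really a triple \<open>A\<close>, \<open>B\<close>, \<open>f\<close> with \<open>Hom C A B f\<close>.
\<close>

record 'v ccat =
  Ob :: "'v \<Rightarrow> bool"
  Hom :: "'v \<Rightarrow> 'v \<Rightarrow> 'v \<Rightarrow> bool"

definition concrete_category :: "'v::zfc ccat \<Rightarrow> bool" where
  "concrete_category C \<longleftrightarrow>
     definable 1 {[A] |A. Ob C A} \<and>
     definable 3 {[A, B, f] |A B f. Hom C A B f} \<and>
     (\<forall>A B f. Hom C A B f \<longrightarrow> Ob C A \<and> Ob C B \<and> is_fun f A B) \<and>
     (\<forall>A B. Ob C A \<longrightarrow> Ob C B \<longrightarrow> (\<exists>h. \<forall>f. f \<in>\<^sub>V h \<longleftrightarrow> Hom C A B f)) \<and>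
     (\<forall>A. Ob C A \<longrightarrow> Hom C A A (vid A)) \<and>
     (\<forall>A B D f g. Hom C A B f \<longrightarrow> Hom C B D g \<longrightarrow> Hom C A D (g \<circ>\<^sub>V f))"

definition absolute_category_by :: "'v::zfc ccat \<Rightarrow> fm \<Rightarrow> 'v list \<Rightarrow> bool" where
  "absolute_category_by C \<phi> ps \<longleftrightarrow>
     concrete_category C \<and> absolute \<phi> 3 ps \<and>
     (\<forall>A B f. is_fun f A B \<longrightarrow>
        (holds UNIV \<phi> ([A, B, f] @ ps) \<longleftrightarrow> Ob C A \<and> Ob C B \<and> Hom C A B f))"

definition supports_elementary_embeddings :: "'v::zfc ccat \<Rightarrow> bool" where
  "supports_elementary_embeddings C \<longleftrightarrow>
     (\<forall>j M X. elementary_embedding j M \<longrightarrow> Ob C X \<longrightarrow> Hom C X (j X) (restr j X))"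

definition monomorphism :: "'v::zfc ccat \<Rightarrow> 'v \<Rightarrow> 'v \<Rightarrow> 'v \<Rightarrow> bool" where
  "monomorphism C A B m \<longleftrightarrow> Hom C A B m \<and>
     (\<forall>Z g h. Hom C Z A g \<longrightarrow> Hom C Z A h \<longrightarrow> m \<circ>\<^sub>V g = m \<circ>\<^sub>V h \<longrightarrow> g = h)"

definition epimorphism :: "'v::zfc ccat \<Rightarrow> 'v \<Rightarrow> 'v \<Rightarrow> 'v \<Rightarrow> bool" where
  "epimorphism C A B e \<longleftrightarrow> Hom C A B e \<and>
     (\<forall>Z g h. Hom C B Z g \<longrightarrow> Hom C B Z h \<longrightarrow> g \<circ>\<^sub>V e = h \<circ>\<^sub>V e \<longrightarrow> g = h)"

definition isomorphism :: "'v::zfc ccat \<Rightarrow> 'v \<Rightarrow> 'v \<Rightarrow> 'v \<Rightarrow> bool" where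
  "isomorphism C A B f \<longleftrightarrow> Hom C A B f \<and>
     (\<exists>g. Hom C B A g \<and> g \<circ>\<^sub>V f = vid A \<and> f \<circ>\<^sub>V g = vid B)"

definition extremal_epimorphism :: "'v::zfc ccat \<Rightarrow> 'v \<Rightarrow> 'v \<Rightarrow> 'v \<Rightarrow> bool" where
  "extremal_epimorphism C A B e \<longleftrightarrow> epimorphism C A B e \<and>
     (\<forall>D v m. Hom C A D v \<longrightarrow> monomorphism C D B m \<longrightarrow> e = m \<circ>\<^sub>V v \<longrightarrow> isomorphism C D B m)"

definition orthogonal :: "'v::zfc ccat \<Rightarrow> 'v \<Rightarrow> 'v \<Rightarrow> 'v \<Rightarrow> 'v \<Rightarrow> bool" where
  "orthogonal C X A B f \<longleftrightarrow>
     (\<forall>g. Hom C A X g \<longrightarrow> (\<exists>!g'. Hom C B X g' \<and> g' \<circ>\<^sub>V f = g))"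

section \<open>Reflections\<close>

text \<open>
  An endofunctor, given on objects and on morphisms (by domain, codomain and underlying function),
  and the components of a natural transformation from the identity.
\<close>

record 'v refl_data =
  Lobj :: "'v \<Rightarrow> 'v"
  Lmor :: "'v \<Rightarrow> 'v \<Rightarrow> 'v \<Rightarrow> 'v"
  unit :: "'v \<Rightarrow> 'v"

definition endofunctor :: "'v::zfc ccat \<Rightarrow> 'v refl_data \<Rightarrow> bool" where
  "endofunctor C L \<longleftrightarrow>
     definable 2 {[A, Lobj L A] |A. Ob C A} \<and>
     definable 4 {[A, B, f, Lmor L A B f] |A B f. Hom C A B f} \<and>
     (\<forall>A. Ob C A \<longrightarrow> Ob C (Lobj L A)) \<and>
     (\<forall>A B f. Hom C A B f \<longrightarrow> Hom C (Lobj L A) (Lobj L B) (Lmor L A B f)) \<and>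
     (\<forall>A. Ob C A \<longrightarrow> Lmor L A A (vid A) = vid (Lobj L A)) \<and>
     (\<forall>A B D f g. Hom C A B f \<longrightarrow> Hom C B D g \<longrightarrow>
        Lmor L A D (g \<circ>\<^sub>V f) = Lmor L B D g \<circ>\<^sub>V Lmor L A B f)"

definition unit_natural :: "'v::zfc ccat \<Rightarrow> 'v refl_data \<Rightarrow> bool" where
  "unit_natural C L \<longleftrightarrow>
     definable 2 {[A, unit L A] |A. Ob C A} \<and>
     (\<forall>A. Ob C A \<longrightarrow> Hom C A (Lobj L A) (unit L A)) \<and>
     (\<forall>A B f. Hom C A B f \<longrightarrow> Lmor L A B f \<circ>\<^sub>V unit L A = unit L B \<circ>\<^sub>V f)"

definition reflection :: "'v::zfc ccat \<Rightarrow> 'v refl_data \<Rightarrow> bool" where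
  "reflection C L \<longleftrightarrow> endofunctor C L \<and> unit_natural C L \<and>
     (\<forall>X. Ob C X \<longrightarrow>
        isomorphism C (Lobj L X) (Lobj L (Lobj L X)) (unit L (Lobj L X)) \<and>
        unit L (Lobj L X) = Lmor L X (Lobj L X) (unit L X))"

definition is_local :: "'v::zfc ccat \<Rightarrow> 'v refl_data \<Rightarrow> 'v \<Rightarrow> bool" where
  "is_local C L X \<longleftrightarrow> Ob C X \<and> isomorphism C X (Lobj L X) (unit L X)"

definition extremal_epireflection :: "'v::zfc ccat \<Rightarrow> 'v refl_data \<Rightarrow> bool" where
  "extremal_epireflection C L \<longleftrightarrow> reflection C L \<and>
     (\<forall>X. Ob C X \<longrightarrow> extremal_epimorphism C X (Lobj L X) (unit L X))"

definition absolute_reflection_by :: "'v::zfc ccat \<Rightarrow> 'v refl_data \<Rightarrow> fm \<Rightarrow> 'v list \<Rightarrow> bool" where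
  "absolute_reflection_by C L \<psi> qs \<longleftrightarrow>
     absolute \<psi> 1 qs \<and> (\<forall>X. holds UNIV \<psi> ([X] @ qs) \<longleftrightarrow> is_local C L X)"

text \<open>Sets of morphisms are elements of V whose elements code triples \<open>A\<close>, \<open>B\<close>, \<open>f\<close>.\<close>

definition mor :: "'v::zfc \<Rightarrow> 'v \<Rightarrow> 'v \<Rightarrow> 'v" where
  "mor A B f = opair A (opair B f)"

definition set_of_morphisms :: "'v::zfc ccat \<Rightarrow> 'v \<Rightarrow> bool" where
  "set_of_morphisms C F \<longleftrightarrow> (\<forall>m. m \<in>\<^sub>V F \<longrightarrow> (\<exists>A B f. Hom C A B f \<and> m = mor A B f))"

definition is_localization :: "'v::zfc ccat \<Rightarrow> 'v refl_data \<Rightarrow> 'v \<Rightarrow> bool" where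
  "is_localization C L F \<longleftrightarrow>
     (\<forall>X. Ob C X \<longrightarrow>
        (is_local C L X \<longleftrightarrow> (\<forall>A B f. mor A B f \<in>\<^sub>V F \<longrightarrow> orthogonal C X A B f)))"

end

theory Submission
  imports Defs
begin

text \<open>
  Take for \<open>F\<close> the set of the units \<open>A \<rightarrow> L A\<close> of the objects \<open>A\<close> of rank below \<open>\<kappa>\<close>. Local
  objects are orthogonal to all units (\<open>local_imp_orthogonal\<close>). Conversely, let \<open>X\<close>
  be an object that is not local. By \<open>supercompact_reflection\<close> there is an injective morphism
  \<open>f : A \<rightarrow> X\<close> from an object \<open>A\<close> of rank below \<open>\<kappa>\<close> that is not local either. If \<open>X\<close> were orthogonal
  to \<open>F\<close>, then \<open>f\<close> would factor through the unit of \<open>A\<close>, which would then be a monomorphism as well as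
  an extremal epimorphism, hence an isomorphism, and \<open>A\<close> would be local
  (\<open>orthogonal_vinj_imp_local\<close>).

  The reflection principle comes from an elementary embedding \<open>j : V \<rightarrow> M\<close> with critical point \<open>\<kappa>\<close> whose
  target is so closed that \<open>X\<close> and the restriction \<open>X \<rightarrow> j X\<close> of \<open>j\<close> belong to M and \<open>X\<close> has rank
  below \<open>j \<kappa>\<close> in M (\<open>supercompact_embedding\<close>). The restriction is a morphism because the category
  supports elementary embeddings. By absoluteness, M sees a morphism into \<open>j X\<close> from an object of rank
  below \<open>j \<kappa>\<close> that is not local. Elementarity turns this into the same fact about \<open>X\<close> and \<open>\<kappa>\<close> in V;
  \<open>j\<close> does not move the parameters of the formulas, as they have rank below \<open>\<kappa>\<close> (\<open>j_fixes_below\<close>).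

  Supercompactness speaks of sequences indexed by an ordinal, so obtaining the embedding requires a
  well-ordering of a stage of the cumulative hierarchy (\<open>well_ordering\<close>). Since V is an arbitrary model
  of the axioms, the recursion on the ordinals that produces the hierarchy and the well-ordering takes
  place inside V and concerns definable class functions only. Two calculi keep track of formulas:
  \<open>dfn\<close> for definability in V, and \<open>expr\<close> for formulas whose meaning is compared between V and M.
\<close>

section \<open>Definable predicates and terms\<close>

lemma finite_fv: "finite (fv \<phi>)"
  by (induction \<phi>) auto

lemma sat_cong:
  fixes v w :: "nat \<Rightarrow> 'v::membership"
  shows "(\<And>i. i \<in> fv \<phi> \<Longrightarrow> v i = w i) \<Longrightarrow> sat M \<phi> v \<longleftrightarrow> sat M \<phi> w"
proof (induction \<phi> arbitrary: v w)
  case (FAll i p)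
  have "sat M p (v(i := x)) \<longleftrightarrow> sat M p (w(i := x))" for x
    by (rule FAll.IH) (use FAll.prems in auto)
  then show ?case by simp
next
  case (FAnd p q)
  have "sat M p v \<longleftrightarrow> sat M p w" by (rule FAnd.IH(1)) (use FAnd.prems in auto)
  moreover have "sat M q v \<longleftrightarrow> sat M q w" by (rule FAnd.IH(2)) (use FAnd.prems in auto)
  ultimately show ?case by simp
next
  case (FNeg p)
  have "sat M p v \<longleftrightarrow> sat M p w" by (rule FNeg.IH) (use FNeg.prems in auto)
  then show ?case by simp
qed simp_all

lemma sat_rename:
  "\<exists>\<phi>'. \<forall>M v. sat M \<phi>' v \<longleftrightarrow> sat M \<phi> (\<lambda>i. v (r i) :: 'v::membership)"
proof (induction \<phi> arbitrary: r)
  case (FMem i k)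
  show ?case by (rule exI[of _ "FMem (r i) (r k)"]) simp
next
  case (FEq i k)
  show ?case by (rule exI[of _ "FEq (r i) (r k)"]) simp
next
  case (FNeg p)
  obtain p' where "\<forall>M v. sat M p' v \<longleftrightarrow> sat M p (\<lambda>i. v (r i) :: 'v)"
    using FNeg.IH[of r] by (elim exE)
  then show ?case by (intro exI[of _ "FNeg p'"]) simp
next
  case (FAnd p q)
  obtain p' where p': "\<forall>M v. sat M p' v \<longleftrightarrow> sat M p (\<lambda>i. v (r i) :: 'v)" using FAnd.IH(1)[of r] by (elim exE)
  obtain q' where q': "\<forall>M v. sat M q' v \<longleftrightarrow> sat M q (\<lambda>i. v (r i) :: 'v)" using FAnd.IH(2)[of r] by (elim exE)
  show ?case using p' q' by (intro exI[of _ "FAnd p' q'"]) simp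
next
  case (FAll i p)
  \<comment> \<open>The bound variable has to avoid everything that the free variables are renamed to.\<close>
  have "finite (r ` fv p)" by (simp add: finite_fv)
  then obtain k where k: "k \<notin> r ` fv p" using ex_new_if_finite[OF infinite_UNIV_nat] by blast
  obtain p' where p': "\<forall>M v. sat M p' v \<longleftrightarrow> sat M p (\<lambda>n. v ((r(i := k)) n) :: 'v)"
    using FAll.IH[of "r(i := k)"] by (elim exE)
  have "sat M p (\<lambda>n. (v(k := x)) ((r(i := k)) n)) \<longleftrightarrow> sat M p ((\<lambda>n. v (r n))(i := x))"
    for M v and x :: 'v
    by (rule sat_cong) (use k in auto)
  then have "sat M (FAll k p') v \<longleftrightarrow> sat M (FAll i p) (\<lambda>n. v (r n))" for M and v :: "nat \<Rightarrow> 'v"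
    unfolding sat.simps p'[rule_format] by (intro ball_cong refl)
  then show ?case by (intro exI[of _ "FAll k p'"] allI)
qed

text \<open>
  Quantification in de Bruijn style: the bound value is put in front of the assignment. Quantifier
  rules phrased this way have higher-order patterns as premises, without side conditions on names.
\<close>

lemma sat_all_shifted:
  "\<exists>\<chi>. \<forall>M v. sat M \<chi> v \<longleftrightarrow> (\<forall>x\<in>M. sat M \<phi> (case_nat x v :: nat \<Rightarrow> 'v::membership))"
proof -
  have "finite {k. Suc k \<in> fv \<phi>}"
    using finite_vimageI[OF finite_fv, of Suc] by (simp add: vimage_def)
  then obtain k where k: "Suc k \<notin> fv \<phi>"
    using ex_new_if_finite[OF infinite_UNIV_nat, of "{k. Suc k \<in> fv \<phi>}"] by blast
  obtain \<phi>' where \<phi>': "\<forall>M v. sat M \<phi>' v \<longleftrightarrow> sat M \<phi> (\<lambda>i. v (case_nat k id i) :: 'v)"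
    using sat_rename[of \<phi> "case_nat k id"] by (elim exE)
  have "sat M \<phi> (\<lambda>i. (v(k := x)) (case_nat k id i)) \<longleftrightarrow> sat M \<phi> (case_nat x v)"
    for M v and x :: 'v
    by (rule sat_cong) (use k in \<open>auto split: nat.split\<close>)
  then have "sat M (FAll k \<phi>') v \<longleftrightarrow> (\<forall>x\<in>M. sat M \<phi> (case_nat x v))" for M and v :: "nat \<Rightarrow> 'v"
    unfolding sat.simps \<phi>'[rule_format] by (intro ball_cong refl)
  then show ?thesis by (intro exI[of _ "FAll k \<phi>'"] allI)
qed

definition interleave :: "(nat \<Rightarrow> 'v) \<Rightarrow> (nat \<Rightarrow> 'v) \<Rightarrow> nat \<Rightarrow> 'v" where
  "interleave v w i = (if even i then v (i div 2) else w (i div 2))"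

text \<open>
  A predicate of assignments is \<open>dfn\<close> when a formula expresses it in V. The odd variables of the
  formula carry parameters; splitting them off makes closed terms usable as constants, and
  the rules below derive definability by following the shape of a HOL expression.
\<close>

definition dfn :: "((nat \<Rightarrow> 'v::membership) \<Rightarrow> bool) \<Rightarrow> bool" where
  "dfn P \<longleftrightarrow> (\<exists>\<phi> w. \<forall>v. P v \<longleftrightarrow> sat UNIV \<phi> (interleave v w))"

definition dfnt :: "((nat \<Rightarrow> 'v::membership) \<Rightarrow> 'v) \<Rightarrow> bool" where
  "dfnt s \<longleftrightarrow> dfn (\<lambda>v. v 0 = s (\<lambda>i. v (Suc i)))"

lemma dfnI:
  assumes "\<And>v. P v \<longleftrightarrow> sat UNIV \<phi> (\<lambda>i. interleave v w (r i))"
  shows "dfn P"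
proof -
  obtain \<phi>' where "\<forall>M v. sat M \<phi>' v \<longleftrightarrow> sat M \<phi> (\<lambda>i. v (r i) :: 'a)"
    using sat_rename[of \<phi> r] by (elim exE)
  then show ?thesis unfolding dfn_def using assms by blast
qed

lemma dfn_mem_var: "dfn (\<lambda>v. v i \<in>\<^sub>V v k)"
  by (rule dfnI[where \<phi>="FMem i k" and r="\<lambda>i. 2 * i"]) (simp add: interleave_def)

lemma dfn_eq_var: "dfn (\<lambda>v. v i = v k)"
  by (rule dfnI[where \<phi>="FEq i k" and r="\<lambda>i. 2 * i"]) (simp add: interleave_def)

lemma dfn_eq_const: "dfn (\<lambda>v. v i = c)"
  by (rule dfnI[where \<phi>="FEq 0 1" and r="\<lambda>n. if n = 0 then 2 * i else 1" and w="\<lambda>_. c"])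
    (simp add: interleave_def)

lemma dfn_not: "dfn P \<Longrightarrow> dfn (\<lambda>v. \<not> P v)"
  unfolding dfn_def by (metis sat.simps(3))

lemma dfn_and:
  assumes "dfn P" "dfn (Q :: (nat \<Rightarrow> 'v::membership) \<Rightarrow> bool)"
  shows "dfn (\<lambda>v. P v \<and> Q v)"
proof -
  obtain p u where p: "\<And>v. P v \<longleftrightarrow> sat UNIV p (interleave v u)"
    using assms(1) unfolding dfn_def by blast
  obtain q w where q: "\<And>v. Q v \<longleftrightarrow> sat UNIV q (interleave v w)"
    using assms(2) unfolding dfn_def by blast
  \<comment> \<open>The parameters of the conjunction are those of both conjuncts, interleaved again.\<close>
  define r where "r i = (if even i then i else 2 * (2 * (i div 2)) + 1)" for i :: nat
  define s where "s i = (if even i then i else 2 * (2 * (i div 2) + 1) + 1)" for i :: nat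
  have r: "(\<lambda>i. interleave v (interleave u w) (r i)) = interleave v u" for v
    by (rule ext) (auto simp: interleave_def r_def elim!: oddE)
  have s: "(\<lambda>i. interleave v (interleave u w) (s i)) = interleave v w" for v
    by (rule ext) (auto simp: interleave_def s_def elim!: oddE)
  obtain p' where p': "\<forall>M v. sat M p' v \<longleftrightarrow> sat M p (\<lambda>i. v (r i) :: 'v)"
    using sat_rename[of p r] by (elim exE)
  obtain q' where q': "\<forall>M v. sat M q' v \<longleftrightarrow> sat M q (\<lambda>i. v (s i) :: 'v)"
    using sat_rename[of q s] by (elim exE)
  show ?thesis unfolding dfn_def
    by (rule exI[of _ "FAnd p' q'"], rule exI[of _ "interleave u w"]) (simp add: p p' q q' r s)
qed

lemma dfn_all:
  assumes "dfn (\<lambda>v. P (\<lambda>i. v (Suc i)) (v 0))"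
  shows "dfn (\<lambda>v. \<forall>x. P v (x :: 'v::membership))"
proof -
  obtain \<phi> w where "\<And>v. P (\<lambda>i. v (Suc i)) (v 0) \<longleftrightarrow> sat UNIV \<phi> (interleave v w)"
    using assms unfolding dfn_def by blast
  from this[of "case_nat _ _"]
  have \<phi>: "P v x \<longleftrightarrow> sat UNIV \<phi> (interleave (case_nat x v) w)" for v x by simp
  define r where "r i = (if i = 0 then 0 else if even i then i - 1 else Suc i)" for i :: nat
  have "case_nat x (interleave v w) (r i) = interleave (case_nat x v) w i" for x v i
  proof (cases "even i")
    case True
    then show ?thesis
      by (cases "i = 0") (auto simp: interleave_def r_def elim!: evenE split: nat.split)
  next
    case False
    then show ?thesis by (auto simp: interleave_def r_def odd_pos)
  qed
  then have r: "(\<lambda>i. case_nat x (interleave v w) (r i)) = interleave (case_nat x v) w" for x v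
    by (rule ext)
  obtain \<phi>' where \<phi>': "\<forall>M v. sat M \<phi>' v \<longleftrightarrow> sat M \<phi> (\<lambda>i. v (r i) :: 'v)"
    using sat_rename[of \<phi> r] by (elim exE)
  obtain \<chi> where \<chi>: "\<forall>M v. sat M \<chi> v \<longleftrightarrow> (\<forall>x\<in>M. sat M \<phi>' (case_nat x v :: nat \<Rightarrow> 'v))"
    using sat_all_shifted[of \<phi>'] by (elim exE)
  have "(\<forall>x. P v x) \<longleftrightarrow> sat UNIV \<chi> (interleave v w)" for v
    by (simp only: \<chi> \<phi>' r \<phi> ball_UNIV)
  then show ?thesis unfolding dfn_def by blast
qed

lemma dfn_reindex:
  assumes "dfn P"
  shows "dfn (\<lambda>v. P (\<lambda>i. v (r i) :: 'v::membership))"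
proof -
  obtain \<phi> w where \<phi>: "\<And>v. P v \<longleftrightarrow> sat UNIV \<phi> (interleave v w)"
    using assms unfolding dfn_def by blast
  have "interleave (\<lambda>i. v (r i)) w
      = (\<lambda>i. interleave v w (if even i then 2 * r (i div 2) else i))" for v
    by (rule ext) (simp add: interleave_def)
  then show ?thesis
    by (intro dfnI[where \<phi>=\<phi> and r="\<lambda>i. if even i then 2 * r (i div 2) else i" and w=w])
      (simp add: \<phi>)
qed

lemma dfn_or:
  assumes "dfn P" "dfn Q"
  shows "dfn (\<lambda>v. P v \<or> Q v)"
proof -
  have "dfn (\<lambda>v. \<not> (\<not> P v \<and> \<not> Q v))" by (intro dfn_not dfn_and assms)
  then show ?thesis by simp
qed

lemma dfn_imp:
  assumes "dfn P" "dfn Q"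
  shows "dfn (\<lambda>v. P v \<longrightarrow> Q v)"
proof -
  have "dfn (\<lambda>v. \<not> P v \<or> Q v)" by (intro dfn_not dfn_or assms)
  then show ?thesis by (simp only: imp_conv_disj)
qed

lemma dfn_iff:
  assumes "dfn P" "dfn Q"
  shows "dfn (\<lambda>v. P v \<longleftrightarrow> Q v)"
proof -
  have "dfn (\<lambda>v. (P v \<longrightarrow> Q v) \<and> (Q v \<longrightarrow> P v))" by (intro dfn_and dfn_imp assms)
  then show ?thesis by (simp only: iff_conv_conj_imp[symmetric])
qed

lemma dfn_ex:
  assumes "dfn (\<lambda>v. P (\<lambda>i. v (Suc i)) (v 0))"
  shows "dfn (\<lambda>v. \<exists>x. P v (x :: 'v::membership))"
proof -
  have "dfn (\<lambda>v. \<not> (\<forall>x. \<not> P v x))" by (intro dfn_not dfn_all assms)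
  then show ?thesis by simp
qed

lemma dfnt_var: "dfnt (\<lambda>v. v i)"
  unfolding dfnt_def by (rule dfn_eq_var)

lemma dfnt_const: "dfnt (\<lambda>v. c)"
  unfolding dfnt_def by (rule dfn_eq_const)

lemma dfnt_reindex: "dfnt s \<Longrightarrow> dfnt (\<lambda>v. s (\<lambda>i. v (r i)))"
  unfolding dfnt_def
  using dfn_reindex[where P="\<lambda>v. v 0 = s (\<lambda>i. v (Suc i))" and r="\<lambda>i. case_nat 0 (Suc \<circ> r) i"]
  by simp

text \<open>
  Terms are eliminated from formulas by naming their values with a quantifier.
\<close>

lemma dfn_subst:
  assumes "dfnt s" "dfn (\<lambda>v. P (\<lambda>i. v (Suc i)) (v 0))"
  shows "dfn (\<lambda>v. P v (s v))"
proof -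
  have "dfn (\<lambda>v. \<exists>x. x = s v \<and> P v x)"
    by (intro dfn_ex dfn_and assms(2) assms(1)[unfolded dfnt_def])
  then show ?thesis by simp
qed

lemma dfn_comp1:
  assumes "dfn (\<lambda>v. P (v 0))" "dfnt s"
  shows "dfn (\<lambda>v. P (s v))"
  by (rule dfn_subst[where P="\<lambda>v x. P x"]) (use assms in simp_all)

lemma dfn_comp2:
  assumes "dfn (\<lambda>v. P (v 0) (v 1))" "dfnt s" "dfnt t"
  shows "dfn (\<lambda>v. P (s v) (t v))"
proof (rule dfn_subst[where P="\<lambda>v x. P x (t v)"])
  have "dfn (\<lambda>v. P (v 1) (v 0))"
    using dfn_reindex[OF assms(1), of "\<lambda>i. if i = 0 then 1 else 0"] by simp
  then have "dfn (\<lambda>v. P (v (Suc 0)) (v 0))" by simp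
  then show "dfn (\<lambda>v. P (v 0) (t (\<lambda>i. v (Suc i))))"
    by (rule dfn_subst[where P="\<lambda>v. P (v 0)" and s="\<lambda>v. t (\<lambda>i. v (Suc i))",
          OF dfnt_reindex[OF assms(3), of Suc]])
qed (rule assms)

lemma dfn_comp3:
  assumes "dfn (\<lambda>v. P (v 0) (v 1) (v 2))" "dfnt s" "dfnt t" "dfnt u"
  shows "dfn (\<lambda>v. P (s v) (t v) (u v))"
proof -
  have 1: "dfn (\<lambda>v. P (v 2) (v 1) (v 0))"
    using dfn_reindex[OF assms(1), of "\<lambda>i. if i = 0 then 2 else if i = 1 then 1 else 0"] by simp
  have 2: "dfn (\<lambda>v. P (v 1) (v 0) (u (\<lambda>i. v (Suc (Suc i)))))"
    using dfn_subst[where P="\<lambda>v. P (v 1) (v 0)" and s="\<lambda>v. u (\<lambda>i. v (Suc (Suc i)))"]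
      dfnt_reindex[OF assms(4), of "\<lambda>i. Suc (Suc i)"] 1
    by (simp add: numeral_2_eq_2)
  have 3: "dfn (\<lambda>v. P (v 0) (t (\<lambda>i. v (Suc i))) (u (\<lambda>i. v (Suc i))))"
    using dfn_subst[where P="\<lambda>v x. P (v 0) x (u (\<lambda>i. v (Suc i)))" and s="\<lambda>v. t (\<lambda>i. v (Suc i))"]
      dfnt_reindex[OF assms(3), of Suc] 2
    by simp
  show ?thesis
    by (rule dfn_subst[where P="\<lambda>v x. P x (t v) (u v)"]) (use assms(2) 3 in simp_all)
qed

lemma dfnt_comp1:
  assumes "dfnt (\<lambda>v. F (v 0))" "dfnt s"
  shows "dfnt (\<lambda>v. F (s v))"
proof -
  have "dfn (\<lambda>v. v 1 = F (v 0))"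
    using dfn_reindex[OF assms(1)[unfolded dfnt_def], of "\<lambda>i. if i = 0 then 1 else 0"] by simp
  then have "dfn (\<lambda>v. v 0 = F (s (\<lambda>i. v (Suc i))))"
    using dfn_comp2[where P="\<lambda>x y. y = F x" and s="\<lambda>v. s (\<lambda>i. v (Suc i))" and t="\<lambda>v. v 0"]
      dfnt_reindex[OF assms(2), of Suc] dfnt_var by blast
  then show ?thesis by (simp add: dfnt_def)
qed

lemma dfnt_comp2:
  assumes "dfnt (\<lambda>v. F (v 0) (v 1))" "dfnt s" "dfnt t"
  shows "dfnt (\<lambda>v. F (s v) (t v))"
proof -
  have "dfn (\<lambda>v. v 2 = F (v 0) (v 1))"
    using dfn_reindex[OF assms(1)[unfolded dfnt_def], of "\<lambda>i. if i = 0 then 2 else i - 1"]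
    by simp
  then have "dfn (\<lambda>v. v 0 = F (s (\<lambda>i. v (Suc i))) (t (\<lambda>i. v (Suc i))))"
    using dfn_comp3[where P="\<lambda>x y z. z = F x y" and s="\<lambda>v. s (\<lambda>i. v (Suc i))"
        and t="\<lambda>v. t (\<lambda>i. v (Suc i))" and u="\<lambda>v. v 0"]
      dfnt_reindex[OF assms(2), of Suc] dfnt_reindex[OF assms(3), of Suc] dfnt_var by blast
  then show ?thesis by (simp add: dfnt_def)
qed

lemmas dfn_mem = dfn_comp2[where P="\<lambda>x y. x \<in>\<^sub>V y", OF dfn_mem_var]
lemmas dfn_eq = dfn_comp2[where P="\<lambda>x y. x = y", OF dfn_eq_var]

lemma dfnt_the:
  assumes "dfn (\<lambda>v. Q (\<lambda>i. v (Suc i)) (v 0))" "\<And>v. \<exists>!y. Q v y"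
  shows "dfnt (\<lambda>v. THE y. Q v y)"
proof -
  have "y = (THE y. Q v y) \<longleftrightarrow> Q v y" for v y
    using theI'[OF assms(2)[of v]] assms(2)[of v] by auto
  then show ?thesis unfolding dfnt_def using assms(1) by simp
qed

lemma dfnt_if:
  assumes "dfn P" "dfnt s" "dfnt t"
  shows "dfnt (\<lambda>v. if P v then s v else t v)"
proof -
  have "dfn (\<lambda>v. (P (\<lambda>i. v (Suc i)) \<longrightarrow> v 0 = s (\<lambda>i. v (Suc i))) \<and>
                 (\<not> P (\<lambda>i. v (Suc i)) \<longrightarrow> v 0 = t (\<lambda>i. v (Suc i))))"
    by (intro dfn_and dfn_imp dfn_not dfn_reindex[OF assms(1)] assms(2,3)[unfolded dfnt_def])
  then show ?thesis unfolding dfnt_def by (rule back_subst[where P=dfn]) (auto simp: fun_eq_iff)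
qed

lemmas dfn_rules = dfnt_const dfnt_var dfn_not dfn_and dfn_or dfn_imp dfn_iff
  dfn_all dfn_ex dfn_mem dfn_eq dfnt_if

lemma definable_imp_dfn:
  assumes "definable n S"
  shows "dfn (\<lambda>v. map v [0..<n] \<in> S)"
proof -
  obtain \<phi> ps where \<phi>: "fv \<phi> \<subseteq> {..<n + length ps}"
      "S = {xs. length xs = n \<and> holds UNIV \<phi> (xs @ ps)}"
    using assms unfolding definable_def by blast
  have "sat UNIV \<phi> (\<lambda>i. (map v [0..<n] @ ps) ! i)
      \<longleftrightarrow> sat UNIV \<phi> (\<lambda>i. interleave v (\<lambda>i. ps ! i) (if i < n then 2 * i else 2 * (i - n) + 1))"
    for v
    by (rule sat_cong) (auto simp: nth_append interleave_def)
  then show ?thesis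
    by (intro dfnI[where \<phi>=\<phi> and w="\<lambda>i. ps ! i"
          and r="\<lambda>i. if i < n then 2 * i else 2 * (i - n) + 1"])
      (simp add: \<phi>(2) holds_def)
qed

section \<open>The axioms for definable classes\<close>

definition small :: "('v::zfc \<Rightarrow> bool) \<Rightarrow> bool" where
  "small P \<longleftrightarrow> (\<exists>s. \<forall>x. x \<in>\<^sub>V s \<longleftrightarrow> P x)"

lemmas zfc_axioms_UNIV = zfc_UNIV[unfolded zfc_model_def, simplified]

lemma extensionality:
  assumes "\<And>z. z \<in>\<^sub>V x \<longleftrightarrow> z \<in>\<^sub>V y"
  shows "x = (y :: 'v::zfc)"
proof -
  have "\<forall>x y. (\<forall>z. z \<in>\<^sub>V x \<longleftrightarrow> z \<in>\<^sub>V y) \<longrightarrow> x = (y :: 'v)"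
    using zfc_axioms_UNIV by (elim conjE) assumption
  then show ?thesis using assms by blast
qed

lemma foundation:
  assumes "y \<in>\<^sub>V (x :: 'v::zfc)"
  shows "\<exists>y. y \<in>\<^sub>V x \<and> (\<forall>z. z \<in>\<^sub>V x \<longrightarrow> \<not> z \<in>\<^sub>V y)"
proof -
  have "\<forall>x. (\<exists>y. y \<in>\<^sub>V x) \<longrightarrow> (\<exists>y. y \<in>\<^sub>V x \<and> (\<forall>z. z \<in>\<^sub>V x \<longrightarrow> \<not> z \<in>\<^sub>V (y :: 'v)))"
    using zfc_axioms_UNIV by (elim conjE) assumption
  then show ?thesis using assms by blast
qed

lemma small_upair: "small (\<lambda>z. z = x \<or> z = (y :: 'v::zfc))"
proof -
  have "\<forall>x y. \<exists>p. \<forall>z. z \<in>\<^sub>V p \<longleftrightarrow> z = x \<or> z = (y :: 'v)"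
    using zfc_axioms_UNIV by (elim conjE) assumption
  then show ?thesis unfolding small_def by blast
qed

lemma small_Union: "small (\<lambda>z. \<exists>y. z \<in>\<^sub>V y \<and> y \<in>\<^sub>V (x :: 'v::zfc))"
proof -
  have "\<forall>x. \<exists>u. \<forall>z. z \<in>\<^sub>V u \<longleftrightarrow> (\<exists>y. z \<in>\<^sub>V y \<and> y \<in>\<^sub>V (x :: 'v))"
    using zfc_axioms_UNIV by (elim conjE) assumption
  then show ?thesis unfolding small_def by blast
qed

lemma small_Pow: "small (\<lambda>z. vsubset z (x :: 'v::zfc))"
proof -
  have "\<forall>x. \<exists>p. \<forall>z. z \<in>\<^sub>V p \<longleftrightarrow> (\<forall>w. w \<in>\<^sub>V z \<longrightarrow> w \<in>\<^sub>V (x :: 'v))"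
    using zfc_axioms_UNIV by (elim conjE) assumption
  then show ?thesis unfolding small_def vsubset_def by blast
qed

lemma infinity:
  "\<exists>x :: 'v::zfc. (\<exists>e. e \<in>\<^sub>V x \<and> (\<forall>z. \<not> z \<in>\<^sub>V e)) \<and>
     (\<forall>y. y \<in>\<^sub>V x \<longrightarrow> (\<exists>s. s \<in>\<^sub>V x \<and> (\<forall>z. z \<in>\<^sub>V s \<longleftrightarrow> z \<in>\<^sub>V y \<or> z = y)))"
proof -
  show ?thesis using zfc_axioms_UNIV by (elim conjE) assumption
qed

lemma transversal:
  assumes "\<And>y. y \<in>\<^sub>V x \<Longrightarrow> \<exists>z. z \<in>\<^sub>V y"
    and "\<And>y y' z. y \<in>\<^sub>V x \<Longrightarrow> y' \<in>\<^sub>V x \<Longrightarrow> z \<in>\<^sub>V y \<Longrightarrow> z \<in>\<^sub>V y' \<Longrightarrow> y = (y' :: 'v::zfc)"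
  shows "\<exists>c. \<forall>y. y \<in>\<^sub>V x \<longrightarrow> (\<exists>!z. z \<in>\<^sub>V y \<and> z \<in>\<^sub>V c)"
proof -
  have "\<forall>x. (\<forall>y. y \<in>\<^sub>V x \<longrightarrow> (\<exists>z. z \<in>\<^sub>V y)) \<and>
        (\<forall>y y'. y \<in>\<^sub>V x \<and> y' \<in>\<^sub>V x \<and> y \<noteq> y' \<longrightarrow> (\<forall>z. z \<in>\<^sub>V y \<longrightarrow> \<not> z \<in>\<^sub>V y')) \<longrightarrow>
        (\<exists>c. \<forall>y. y \<in>\<^sub>V x \<longrightarrow> (\<exists>!z. z \<in>\<^sub>V y \<and> z \<in>\<^sub>V (c :: 'v)))"
    using zfc_axioms_UNIV by (elim conjE) assumption
  then show ?thesis using assms by blast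
qed

lemma small_sep:
  assumes "dfn (\<lambda>v. P (v 0))" "\<And>x. P x \<Longrightarrow> x \<in>\<^sub>V a"
  shows "small (P :: 'v::zfc \<Rightarrow> bool)"
proof -
  obtain \<phi> w where \<phi>: "\<And>v. P (v 0) \<longleftrightarrow> sat UNIV \<phi> (interleave v w)"
    using assms(1) unfolding dfn_def by blast
  have "(interleave (\<lambda>_. a) w)(0 := x) = interleave ((\<lambda>_. a)(0 := x)) w" for x
    by (rule ext) (auto simp: interleave_def)
  with \<phi>[of "(\<lambda>_. a)(0 := x)" for x]
  have "P x \<longleftrightarrow> sat UNIV \<phi> ((interleave (\<lambda>_. a) w)(0 := x))" for x by simp
  moreover have "\<forall>\<phi> v a. \<exists>s. \<forall>x. x \<in>\<^sub>V s \<longleftrightarrow> x \<in>\<^sub>V a \<and> sat UNIV \<phi> (v(0 := x :: 'v))"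
    using zfc_axioms_UNIV by (elim conjE) assumption
  ultimately have "\<exists>s. \<forall>x. x \<in>\<^sub>V s \<longleftrightarrow> x \<in>\<^sub>V a \<and> P x" by simp
  then show ?thesis using assms(2) unfolding small_def by meson
qed

lemma small_image:
  assumes "dfnt (\<lambda>v. F (v 0))"
  shows "small (\<lambda>y. \<exists>x. x \<in>\<^sub>V (a :: 'v::zfc) \<and> y = F x)"
proof -
  obtain \<phi> w where \<phi>: "\<And>v. v 0 = F (v (Suc 0)) \<longleftrightarrow> sat UNIV \<phi> (interleave v w)"
    using assms(1) unfolding dfn_def dfnt_def by blast
  define r where "r i = (if i = 0 then 1 else if i = 2 then 0 else i + 2)" for i :: nat
  obtain \<phi>' where \<phi>': "\<forall>M v. sat M \<phi>' v \<longleftrightarrow> sat M \<phi> (\<lambda>i. v (r i) :: 'v)"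
    using sat_rename[of \<phi> r] by (elim exE)
  define e where "e i = interleave (\<lambda>_. a) w (i - 2)" for i
  have "(\<lambda>i. (e(0 := x, 1 := y)) (r i)) = interleave ((\<lambda>_. a)(0 := y, 1 := x)) w" for x y
    by (rule ext) (auto simp: interleave_def r_def e_def elim!: evenE)
  with \<phi>' \<phi>[of "(\<lambda>_. a)(0 := y, 1 := x)" for x y]
  have eq: "y = F x \<longleftrightarrow> sat UNIV \<phi>' (e(0 := x, 1 := y))" for x y by simp
  have "\<forall>\<phi> v a. (\<forall>x y y'. x \<in>\<^sub>V a \<and> sat UNIV \<phi> (v(0 := x, 1 := y)) \<and>
              sat UNIV \<phi> (v(0 := x, 1 := y')) \<longrightarrow> y = y') \<longrightarrow>
          (\<exists>s. \<forall>y. y \<in>\<^sub>V s \<longleftrightarrow> (\<exists>x. x \<in>\<^sub>V a \<and> sat UNIV \<phi> (v(0 := x, 1 := y :: 'v))))"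
    using zfc_axioms_UNIV by (elim conjE) (simp only: One_nat_def)
  then have "(\<forall>x y y'. x \<in>\<^sub>V a \<and> y = F x \<and> y' = F x \<longrightarrow> y = y') \<longrightarrow>
          (\<exists>s. \<forall>y. y \<in>\<^sub>V s \<longleftrightarrow> (\<exists>x. x \<in>\<^sub>V a \<and> y = F x))"
    unfolding eq by (elim allE[of _ \<phi>'] allE[of _ e] allE[of _ a])
  then show ?thesis unfolding small_def by blast
qed

lemma the_set_eqI: "(\<And>x. x \<in>\<^sub>V s \<longleftrightarrow> P x) \<Longrightarrow> the_set P = s"
  unfolding the_set_def by (rule the_equality) (auto intro: extensionality)

lemma mem_the_set: "small P \<Longrightarrow> x \<in>\<^sub>V the_set P \<longleftrightarrow> P x"
  unfolding small_def by (metis the_set_eqI)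

lemma dfnt_the_set:
  assumes "dfn (\<lambda>v. P (\<lambda>i. v (Suc i)) (v 0))" "\<And>v. small (P v)"
  shows "dfnt (\<lambda>v. the_set (\<lambda>x. P v x :: bool))"
proof -
  have "y = the_set (P v) \<longleftrightarrow> (\<forall>x. x \<in>\<^sub>V y \<longleftrightarrow> P v x)" for v y
    using assms(2)[of v] by (metis mem_the_set the_set_eqI)
  moreover have "dfn (\<lambda>v. \<forall>x. x \<in>\<^sub>V v 0 \<longleftrightarrow> P (\<lambda>i. v (Suc i)) x)"
    using dfn_reindex[OF assms(1), of "case_nat 0 (Suc \<circ> Suc)"] by (intro dfn_rules) simp
  ultimately show ?thesis unfolding dfnt_def by simp
qed

lemma small_Un: "small (\<lambda>z. z \<in>\<^sub>V x \<or> z \<in>\<^sub>V (y :: 'v::zfc))"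
proof -
  have "small (\<lambda>z. \<exists>u. z \<in>\<^sub>V u \<and> u \<in>\<^sub>V the_set (\<lambda>z. z = x \<or> z = y))" by (rule small_Union)
  then show ?thesis by (rule back_subst[where P=small]) (auto simp: mem_the_set[OF small_upair])
qed

lemma small_UN:
  assumes "dfnt (\<lambda>v. F (v 0))"
  shows "small (\<lambda>z. \<exists>x. x \<in>\<^sub>V (a :: 'v::zfc) \<and> z \<in>\<^sub>V F x)"
proof -
  have "small (\<lambda>z. \<exists>u. z \<in>\<^sub>V u \<and> u \<in>\<^sub>V the_set (\<lambda>y. \<exists>x. x \<in>\<^sub>V a \<and> y = F x))" by (rule small_Union)
  then show ?thesis
    by (rule back_subst[where P=small]) (auto simp: mem_the_set[OF small_image[OF assms]])
qed

lemma mem_upair: "z \<in>\<^sub>V upair x y \<longleftrightarrow> z = x \<or> z = (y :: 'v::zfc)"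
  unfolding upair_def by (rule mem_the_set[OF small_upair])

lemma small_insert: "small (\<lambda>z. z \<in>\<^sub>V x \<or> z = (y :: 'v::zfc))"
  using small_Un[of x "upair y y"] by (simp add: mem_upair)

lemma upair_eq_iff: "p = upair x y \<longleftrightarrow> x \<in>\<^sub>V p \<and> y \<in>\<^sub>V p \<and> (\<forall>z. z \<in>\<^sub>V p \<longrightarrow> z = x \<or> z = y)"
  by (auto simp: mem_upair intro: extensionality)

lemma opair_inject: "opair a b = opair c d \<longleftrightarrow> a = c \<and> b = (d :: 'v::zfc)"
proof
  assume eq: "opair a b = opair c d"
  have "z = upair a a \<or> z = upair a b \<longleftrightarrow> z = upair c c \<or> z = upair c d" for z
    using eq unfolding opair_def by (metis mem_upair)
  then show "a = c \<and> b = d" by (metis mem_upair)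
qed simp

lemma dfn_vsubset: "dfnt s \<Longrightarrow> dfnt t \<Longrightarrow> dfn (\<lambda>v. vsubset (s v) (t v))"
  by (rule dfn_comp2[where P=vsubset]) (unfold vsubset_def, intro dfn_rules)

lemma dfnt_upair: "dfnt s \<Longrightarrow> dfnt t \<Longrightarrow> dfnt (\<lambda>v. upair (s v) (t v))"
  by (rule dfnt_comp2[where F=upair])
    (unfold upair_def, intro dfnt_the_set dfn_rules small_upair)

lemma dfnt_opair: "dfnt s \<Longrightarrow> dfnt t \<Longrightarrow> dfnt (\<lambda>v. opair (s v) (t v))"
  by (rule dfnt_comp2[where F=opair]) (unfold opair_def, intro dfnt_upair dfn_rules)

lemma mem_vsucc: "x \<in>\<^sub>V vsucc a \<longleftrightarrow> x \<in>\<^sub>V a \<or> x = (a :: 'v::zfc)"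
  unfolding vsucc_def by (rule mem_the_set[OF small_insert])

lemma dfnt_vsucc: "dfnt s \<Longrightarrow> dfnt (\<lambda>v. vsucc (s v))"
  by (rule dfnt_comp1[where F=vsucc]) (unfold vsucc_def, intro dfnt_the_set dfn_rules small_insert)

lemma small_restr:
  assumes "dfnt (\<lambda>v. F (v 0))"
  shows "small (\<lambda>p. \<exists>x. x \<in>\<^sub>V X \<and> p = opair x (F x))"
  by (rule small_image) (intro dfnt_opair dfnt_var assms)

lemma mem_restr:
  assumes "dfnt (\<lambda>v. F (v 0))"
  shows "p \<in>\<^sub>V restr F X \<longleftrightarrow> (\<exists>x. x \<in>\<^sub>V X \<and> p = opair x (F x))"
  unfolding restr_def by (rule mem_the_set[OF small_restr[OF assms]])

lemma opair_mem_restr: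
  assumes "dfnt (\<lambda>v. F (v 0))"
  shows "opair x y \<in>\<^sub>V restr F X \<longleftrightarrow> x \<in>\<^sub>V X \<and> y = F x"
  by (auto simp: mem_restr[OF assms] opair_inject)

lemmas dfn_set_rules = dfn_rules dfn_vsubset dfnt_upair dfnt_opair dfnt_vsucc

definition vUnion :: "'v::zfc \<Rightarrow> 'v" where
  "vUnion x = the_set (\<lambda>z. \<exists>y. z \<in>\<^sub>V y \<and> y \<in>\<^sub>V x)"

lemma mem_vUnion: "z \<in>\<^sub>V vUnion x \<longleftrightarrow> (\<exists>y. z \<in>\<^sub>V y \<and> y \<in>\<^sub>V x)"
  unfolding vUnion_def by (rule mem_the_set[OF small_Union])

lemma opair_mem_vUnion:
  assumes "opair a b \<in>\<^sub>V f"
  shows "b \<in>\<^sub>V vUnion (vUnion f)"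
  unfolding mem_vUnion using assms by (metis mem_upair opair_def)

lemma ex_minimal:
  assumes "dfn (\<lambda>v. P (v 0))" "x \<in>\<^sub>V a" "P x"
  shows "\<exists>m. m \<in>\<^sub>V a \<and> P m \<and> (\<forall>y. y \<in>\<^sub>V a \<longrightarrow> P y \<longrightarrow> \<not> y \<in>\<^sub>V (m :: 'v::zfc))"
proof -
  have "small (\<lambda>y. y \<in>\<^sub>V a \<and> P y)"
    by (rule small_sep[where a=a]) (intro dfn_set_rules assms(1), simp)
  then obtain s where s: "\<And>y. y \<in>\<^sub>V s \<longleftrightarrow> y \<in>\<^sub>V a \<and> P y" unfolding small_def by blast
  then show ?thesis using foundation[of x s] assms(2,3) by blast
qed

section \<open>Ordinals\<close>

lemma mem_irrefl: "\<not> x \<in>\<^sub>V (x :: 'v::zfc)"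
  using foundation[of x "upair x x"] by (auto simp: mem_upair)

lemma mem_asym: "x \<in>\<^sub>V y \<Longrightarrow> \<not> y \<in>\<^sub>V (x :: 'v::zfc)"
  using foundation[of x "upair x y"] by (auto simp: mem_upair)

lemma mem_no_3_cycle: "x \<in>\<^sub>V y \<Longrightarrow> y \<in>\<^sub>V z \<Longrightarrow> \<not> z \<in>\<^sub>V (x :: 'v::zfc)"
proof
  assume *: "x \<in>\<^sub>V y" "y \<in>\<^sub>V z" "z \<in>\<^sub>V x"
  define t where "t = the_set (\<lambda>w. w \<in>\<^sub>V upair x y \<or> w = z)"
  have t: "w \<in>\<^sub>V t \<longleftrightarrow> w = x \<or> w = y \<or> w = z" for w
    using mem_the_set[OF small_insert, of w "upair x y" z] unfolding t_def by (simp add: mem_upair)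
  then show False using foundation[of x t] * by auto
qed

lemma Ord_trans: "Ord \<alpha> \<Longrightarrow> \<beta> \<in>\<^sub>V \<alpha> \<Longrightarrow> \<gamma> \<in>\<^sub>V \<beta> \<Longrightarrow> \<gamma> \<in>\<^sub>V \<alpha>"
  unfolding Ord_def transitive_set_def by blast

lemma Ord_mem:
  assumes "Ord \<alpha>" "\<beta> \<in>\<^sub>V \<alpha>"
  shows "Ord \<beta>"
  unfolding Ord_def transitive_set_def
proof (intro conjI allI impI)
  fix x y assume "x \<in>\<^sub>V \<beta>" "y \<in>\<^sub>V x"
  then have "x \<in>\<^sub>V \<alpha>" "y \<in>\<^sub>V \<alpha>" using assms Ord_trans by blast+
  then have "y \<in>\<^sub>V \<beta> \<or> y = \<beta> \<or> \<beta> \<in>\<^sub>V y" using assms unfolding Ord_def by blast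
  then show "y \<in>\<^sub>V \<beta>" using \<open>x \<in>\<^sub>V \<beta>\<close> \<open>y \<in>\<^sub>V x\<close> mem_asym mem_no_3_cycle by blast
next
  fix x y assume "x \<in>\<^sub>V \<beta>" "y \<in>\<^sub>V \<beta>"
  then show "x \<in>\<^sub>V y \<or> x = y \<or> y \<in>\<^sub>V x"
    using assms Ord_trans unfolding Ord_def by blast
qed

lemma dfn_Ord: "dfnt s \<Longrightarrow> dfn (\<lambda>v. Ord (s v))"
  by (rule dfn_comp1[where P=Ord]) (unfold Ord_def transitive_set_def, intro dfn_set_rules)

lemma Ord_least:
  assumes P: "dfn (\<lambda>v. P (v 0))" and "Ord \<alpha>" "P \<alpha>"
  shows "\<exists>\<beta>. Ord \<beta> \<and> P \<beta> \<and> (\<forall>\<gamma>. \<gamma> \<in>\<^sub>V \<beta> \<longrightarrow> \<not> P (\<gamma> :: 'v::zfc))"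
proof -
  have "\<alpha> \<in>\<^sub>V vsucc \<alpha>" by (simp add: mem_vsucc)
  then obtain \<beta> where \<beta>: "\<beta> \<in>\<^sub>V vsucc \<alpha>" "P \<beta>" "\<And>\<gamma>. \<gamma> \<in>\<^sub>V vsucc \<alpha> \<Longrightarrow> P \<gamma> \<Longrightarrow> \<not> \<gamma> \<in>\<^sub>V \<beta>"
    using ex_minimal[where P=P, OF P] assms(3) by blast
  have "Ord \<beta>" using \<beta>(1) \<open>Ord \<alpha>\<close> Ord_mem unfolding mem_vsucc by blast
  moreover have "\<gamma> \<in>\<^sub>V vsucc \<alpha>" if "\<gamma> \<in>\<^sub>V \<beta>" for \<gamma>
    using that \<beta>(1) \<open>Ord \<alpha>\<close> Ord_trans unfolding mem_vsucc by blast
  ultimately show ?thesis using \<beta> by blast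
qed

lemma Ord_induct_dfn:
  assumes "dfn (\<lambda>v. P (v 0))" "Ord \<alpha>"
    and step: "\<And>\<beta>. Ord \<beta> \<Longrightarrow> (\<And>\<gamma>. \<gamma> \<in>\<^sub>V \<beta> \<Longrightarrow> P \<gamma>) \<Longrightarrow> P \<beta>"
  shows "P (\<alpha> :: 'v::zfc)"
proof (rule ccontr)
  assume "\<not> P \<alpha>"
  then show False
    using Ord_least[where P="\<lambda>\<beta>. \<not> P \<beta>", OF dfn_not[OF assms(1)] assms(2)] step by blast
qed

lemma Ord_subset_imp_mem:
  assumes "Ord \<alpha>" "Ord \<beta>" "vsubset \<alpha> \<beta>" "\<alpha> \<noteq> \<beta>"
  shows "\<alpha> \<in>\<^sub>V \<beta>"
proof -
  obtain \<delta> where "\<delta> \<in>\<^sub>V \<beta>" "\<not> \<delta> \<in>\<^sub>V \<alpha>"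
    using assms(3,4) extensionality[of \<alpha> \<beta>] unfolding vsubset_def by blast
  moreover have "dfn (\<lambda>v. \<not> v 0 \<in>\<^sub>V \<alpha>)" by (intro dfn_set_rules)
  ultimately obtain \<gamma> where \<gamma>: "\<gamma> \<in>\<^sub>V \<beta>" "\<not> \<gamma> \<in>\<^sub>V \<alpha>"
    "\<And>\<delta>. \<delta> \<in>\<^sub>V \<beta> \<Longrightarrow> \<not> \<delta> \<in>\<^sub>V \<alpha> \<Longrightarrow> \<not> \<delta> \<in>\<^sub>V \<gamma>"
    using ex_minimal[where P="\<lambda>x. \<not> x \<in>\<^sub>V \<alpha>"] by blast
  \<comment> \<open>The least element missing from \<open>\<alpha>\<close> is \<open>\<alpha>\<close> itself.\<close>
  have "z \<in>\<^sub>V \<gamma> \<longleftrightarrow> z \<in>\<^sub>V \<alpha>" for z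
  proof
    assume "z \<in>\<^sub>V \<gamma>"
    then show "z \<in>\<^sub>V \<alpha>" using \<gamma> assms(2) Ord_trans by blast
  next
    assume "z \<in>\<^sub>V \<alpha>"
    then have "z \<in>\<^sub>V \<gamma> \<or> z = \<gamma> \<or> \<gamma> \<in>\<^sub>V z"
      using assms(2,3) \<gamma>(1) unfolding Ord_def vsubset_def by blast
    then show "z \<in>\<^sub>V \<gamma>" using \<open>z \<in>\<^sub>V \<alpha>\<close> \<gamma>(2) assms(1) Ord_trans by blast
  qed
  then have "\<gamma> = \<alpha>" by (rule extensionality)
  then show ?thesis using \<gamma> by blast
qed

lemma Ord_linear:
  assumes "Ord \<alpha>" "Ord \<beta>"
  shows "\<alpha> \<in>\<^sub>V \<beta> \<or> \<alpha> = \<beta> \<or> \<beta> \<in>\<^sub>V \<alpha>"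
proof -
  have "small (\<lambda>z. z \<in>\<^sub>V \<alpha> \<and> z \<in>\<^sub>V \<beta>)"
    by (rule small_sep[where a=\<alpha>]) (intro dfn_set_rules, simp)
  then obtain \<gamma> where \<gamma>: "\<And>z. z \<in>\<^sub>V \<gamma> \<longleftrightarrow> z \<in>\<^sub>V \<alpha> \<and> z \<in>\<^sub>V \<beta>" unfolding small_def by blast
  have "Ord \<gamma>" using assms unfolding Ord_def transitive_set_def \<gamma> by blast
  then have "\<gamma> = \<alpha> \<or> \<gamma> \<in>\<^sub>V \<alpha>" "\<gamma> = \<beta> \<or> \<gamma> \<in>\<^sub>V \<beta>"
    using Ord_subset_imp_mem assms \<gamma> unfolding vsubset_def by blast+
  then show ?thesis using \<gamma>[of \<gamma>] mem_irrefl[of \<gamma>] by blast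
qed

lemma Ord_vsucc:
  assumes "Ord \<alpha>"
  shows "Ord (vsucc \<alpha>)"
proof -
  have "y \<in>\<^sub>V vsucc \<alpha>" if "x \<in>\<^sub>V vsucc \<alpha>" "y \<in>\<^sub>V x" for x y
    using that Ord_trans[OF assms, of x y] unfolding mem_vsucc by auto
  moreover have "x \<in>\<^sub>V y \<or> x = y \<or> y \<in>\<^sub>V x" if "x \<in>\<^sub>V vsucc \<alpha>" "y \<in>\<^sub>V vsucc \<alpha>" for x y
    using that assms unfolding mem_vsucc Ord_def by auto
  ultimately show ?thesis unfolding Ord_def transitive_set_def by blast
qed

lemma Ord_vUnion:
  assumes "\<And>\<alpha>. \<alpha> \<in>\<^sub>V A \<Longrightarrow> Ord \<alpha>"
  shows "Ord (vUnion A)"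
proof -
  have "Ord x" if "x \<in>\<^sub>V vUnion A" for x
    using that assms Ord_mem unfolding mem_vUnion by blast
  then have "x \<in>\<^sub>V y \<or> x = y \<or> y \<in>\<^sub>V x" if "x \<in>\<^sub>V vUnion A" "y \<in>\<^sub>V vUnion A" for x y
    using that Ord_linear by blast
  moreover have "transitive_set (vUnion A)"
    using assms Ord_trans unfolding transitive_set_def mem_vUnion by blast
  ultimately show ?thesis unfolding Ord_def by blast
qed

lemma Ord_not_small: "\<not> small (Ord :: 'v::zfc \<Rightarrow> bool)"
proof
  assume "small (Ord :: 'v \<Rightarrow> bool)"
  then have s: "x \<in>\<^sub>V the_set Ord \<longleftrightarrow> Ord x" for x :: 'v by (rule mem_the_set)
  have "transitive_set (the_set Ord :: 'v)" unfolding transitive_set_def s using Ord_mem by blast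
  then have "Ord (the_set Ord :: 'v)"
    using Ord_linear unfolding Ord_def[of "the_set Ord"] s by blast
  then show False using s mem_irrefl by blast
qed

section \<open>Recursion on the ordinals\<close>

definition cut :: "'v::zfc \<Rightarrow> 'v \<Rightarrow> 'v" where
  "cut f \<beta> = the_set (\<lambda>p. p \<in>\<^sub>V f \<and> (\<exists>\<gamma> z. \<gamma> \<in>\<^sub>V \<beta> \<and> p = opair \<gamma> z))"

lemma small_cut: "small (\<lambda>p. p \<in>\<^sub>V f \<and> (\<exists>\<gamma> z. \<gamma> \<in>\<^sub>V (\<beta> :: 'v::zfc) \<and> p = opair \<gamma> z))"
  by (rule small_sep[where a=f]) (intro dfn_set_rules, simp)

lemma mem_cut: "p \<in>\<^sub>V cut f \<beta> \<longleftrightarrow> p \<in>\<^sub>V f \<and> (\<exists>\<gamma> z. \<gamma> \<in>\<^sub>V \<beta> \<and> p = opair \<gamma> z)"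
  unfolding cut_def by (rule mem_the_set[OF small_cut])

lemma dfnt_cut: "dfnt s \<Longrightarrow> dfnt t \<Longrightarrow> dfnt (\<lambda>v. cut (s v) (t v))"
  by (rule dfnt_comp2[where F=cut])
    (unfold cut_def, intro dfnt_the_set dfn_set_rules small_cut)

text \<open>
  The set-sized initial parts of the function to be defined. The recursion theorem is proved by
  comparing them, since HOL's own recursion does not apply to ordinals that may be ill-founded.
\<close>

definition approx :: "('v::zfc \<Rightarrow> 'v) \<Rightarrow> 'v \<Rightarrow> 'v \<Rightarrow> bool" where
  "approx G f \<alpha> \<longleftrightarrow> Ord \<alpha> \<and> (\<forall>p. p \<in>\<^sub>V f \<longrightarrow> (\<exists>\<beta> z. \<beta> \<in>\<^sub>V \<alpha> \<and> p = opair \<beta> z)) \<and>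
     (\<forall>\<beta>. \<beta> \<in>\<^sub>V \<alpha> \<longrightarrow> (\<forall>z. opair \<beta> z \<in>\<^sub>V f \<longleftrightarrow> z = G (cut f \<beta>)))"

text \<open>
  Away from the ordinals there is no approximation, and the value is set to the argument. For a
  definable \<open>G\<close> this makes the description a total and definable one.
\<close>

definition ordrec :: "('v::zfc \<Rightarrow> 'v) \<Rightarrow> 'v \<Rightarrow> 'v" where
  "ordrec G \<alpha> = (THE y. (\<exists>f. approx G f \<alpha> \<and> y = G f) \<or> (\<not> (\<exists>f. approx G f \<alpha>) \<and> y = \<alpha>))"

text \<open>
  The value at \<open>\<beta>\<close> is determined by the values below \<open>\<beta>\<close>, so two approximations agree by induction.
\<close>

lemma approx_unique:
  assumes "approx G f \<alpha>" "approx G g \<alpha>" and G: "dfnt (\<lambda>v. G (v 0))"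
  shows "f = g"
proof -
  have eq: "cut f \<beta> = cut g \<beta>" if "\<beta> \<in>\<^sub>V \<alpha>" for \<beta>
  proof -
    have "\<beta> \<in>\<^sub>V \<alpha> \<longrightarrow> cut f \<beta> = cut g \<beta>"
    proof (rule Ord_induct_dfn[where P="\<lambda>\<beta>. \<beta> \<in>\<^sub>V \<alpha> \<longrightarrow> cut f \<beta> = cut g \<beta>"])
      show "dfn (\<lambda>v. v 0 \<in>\<^sub>V \<alpha> \<longrightarrow> cut f (v 0) = cut g (v 0))"
        by (intro dfn_set_rules dfnt_cut)
      show "Ord \<beta>" using assms(1) that Ord_mem unfolding approx_def by blast
    next
      fix \<delta> assume IH: "\<And>\<gamma>. \<gamma> \<in>\<^sub>V \<delta> \<Longrightarrow> \<gamma> \<in>\<^sub>V \<alpha> \<longrightarrow> cut f \<gamma> = cut g \<gamma>"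
      show "\<delta> \<in>\<^sub>V \<alpha> \<longrightarrow> cut f \<delta> = cut g \<delta>"
      proof
        assume "\<delta> \<in>\<^sub>V \<alpha>"
        then have \<alpha>: "\<gamma> \<in>\<^sub>V \<alpha>" if "\<gamma> \<in>\<^sub>V \<delta>" for \<gamma>
          using assms(1) that Ord_trans unfolding approx_def by blast
        have "opair \<gamma> z \<in>\<^sub>V f \<longleftrightarrow> opair \<gamma> z \<in>\<^sub>V g" if "\<gamma> \<in>\<^sub>V \<delta>" for \<gamma> z
          using assms(1,2) \<alpha>[OF that] IH[OF that] unfolding approx_def by simp
        then show "cut f \<delta> = cut g \<delta>" by (intro extensionality) (auto simp: mem_cut)
      qed
    qed
    then show ?thesis using that by blast
  qed
  have "opair \<beta> z \<in>\<^sub>V f \<longleftrightarrow> opair \<beta> z \<in>\<^sub>V g" if "\<beta> \<in>\<^sub>V \<alpha>" for \<beta> z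
    using assms(1,2) that eq[OF that] unfolding approx_def by simp
  moreover have "\<exists>\<beta> z. \<beta> \<in>\<^sub>V \<alpha> \<and> p = opair \<beta> z" if "p \<in>\<^sub>V f \<or> p \<in>\<^sub>V g" for p
    using that assms(1,2) unfolding approx_def by blast
  ultimately show ?thesis by (metis extensionality)
qed

lemma ordrec_ex1:
  assumes "dfnt (\<lambda>v. G (v 0))"
  shows "\<exists>!y. (\<exists>f. approx G f \<alpha> \<and> y = G f) \<or> (\<not> (\<exists>f. approx G f \<alpha>) \<and> y = \<alpha>)"
  using approx_unique[OF _ _ assms] by metis

lemma dfnt_ordrec:
  assumes "dfnt (\<lambda>v. G (v 0))"
  shows "dfnt (\<lambda>v. ordrec G (v 0))"
  unfolding ordrec_def
  by (intro dfnt_the ordrec_ex1[OF assms], unfold approx_def)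
    (intro dfn_set_rules dfn_Ord dfnt_cut dfnt_comp1[OF assms])

lemma ordrec_eq:
  assumes "approx G f \<alpha>" "dfnt (\<lambda>v. G (v 0))"
  shows "ordrec G \<alpha> = G f"
  unfolding ordrec_def by (rule the1_equality[OF ordrec_ex1[OF assms(2)]]) (use assms(1) in blast)

lemma approx_eq_restr:
  assumes f: "approx G f \<alpha>" and G: "dfnt (\<lambda>v. G (v 0))"
  shows "f = restr (ordrec G) \<alpha>"
proof (rule extensionality)
  fix p
  have val: "opair \<beta> z \<in>\<^sub>V f \<longleftrightarrow> z = ordrec G \<beta>" if \<beta>: "\<beta> \<in>\<^sub>V \<alpha>" for \<beta> z
  proof -
    have "Ord \<beta>" "\<And>\<gamma>. \<gamma> \<in>\<^sub>V \<beta> \<Longrightarrow> \<gamma> \<in>\<^sub>V \<alpha>"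
      using f \<beta> Ord_mem Ord_trans unfolding approx_def by blast+
    moreover have "cut (cut f \<beta>) \<gamma> = cut f \<gamma>" if "\<gamma> \<in>\<^sub>V \<beta>" for \<gamma>
      using that \<open>Ord \<beta>\<close> Ord_trans
      by (intro extensionality) (auto simp: mem_cut opair_inject)
    ultimately have "approx G (cut f \<beta>) \<beta>"
      using f unfolding approx_def by (auto simp: mem_cut opair_inject)
    then have "ordrec G \<beta> = G (cut f \<beta>)" using G by (rule ordrec_eq)
    then show ?thesis using f \<beta> unfolding approx_def by simp
  qed
  have "p \<in>\<^sub>V f \<longleftrightarrow> (\<exists>\<beta> z. \<beta> \<in>\<^sub>V \<alpha> \<and> p = opair \<beta> z \<and> opair \<beta> z \<in>\<^sub>V f)"
    using f unfolding approx_def by blast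
  also have "\<dots> \<longleftrightarrow> p \<in>\<^sub>V restr (ordrec G) \<alpha>"
    unfolding mem_restr[OF dfnt_ordrec[OF G]] using val by metis
  finally show "p \<in>\<^sub>V f \<longleftrightarrow> p \<in>\<^sub>V restr (ordrec G) \<alpha>" .
qed

text \<open>
  By induction on \<open>\<alpha>\<close>, the restriction of \<open>ordrec G\<close> to \<open>\<alpha>\<close> is an approximation.
\<close>

theorem ordrec_rec:
  assumes G: "dfnt (\<lambda>v. G (v 0))" and "Ord \<alpha>"
  shows "ordrec G \<alpha> = G (restr (ordrec G) \<alpha>)"
proof -
  note D = dfnt_ordrec[OF G]
  have "\<exists>f. approx G f \<alpha>"
  proof (rule Ord_induct_dfn[where P="\<lambda>\<alpha>. \<exists>f. approx G f \<alpha>"])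
    show "dfn (\<lambda>v. \<exists>f. approx G f (v 0))"
      unfolding approx_def by (intro dfn_set_rules dfn_Ord dfnt_cut dfnt_comp1[OF G])
  next
    fix \<beta> assume "Ord \<beta>" and IH: "\<And>\<gamma>. \<gamma> \<in>\<^sub>V \<beta> \<Longrightarrow> \<exists>f. approx G f \<gamma>"
    have "ordrec G \<gamma> = G (cut (restr (ordrec G) \<beta>) \<gamma>)" if \<gamma>: "\<gamma> \<in>\<^sub>V \<beta>" for \<gamma>
    proof -
      obtain g where g: "approx G g \<gamma>" using IH[OF \<gamma>] by blast
      have "cut (restr (ordrec G) \<beta>) \<gamma> = restr (ordrec G) \<gamma>"
        using \<gamma> \<open>Ord \<beta>\<close> Ord_trans
        by (intro extensionality) (auto simp: mem_cut mem_restr[OF D] opair_inject)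
      then show ?thesis using ordrec_eq[OF g G] approx_eq_restr[OF g G] by simp
    qed
    then have "approx G (restr (ordrec G) \<beta>) \<beta>"
      using \<open>Ord \<beta>\<close> unfolding approx_def
      by (auto simp: mem_restr[OF D] opair_inject)
    then show "\<exists>f. approx G f \<beta>" by blast
  qed (rule assms)
  then obtain f where "approx G f \<alpha>" by blast
  then show ?thesis using ordrec_eq approx_eq_restr G by metis
qed

section \<open>The cumulative hierarchy\<close>

definition Vstep :: "'v::zfc \<Rightarrow> 'v" where
  "Vstep h = the_set (\<lambda>x. \<exists>\<gamma> w. opair \<gamma> w \<in>\<^sub>V h \<and> vsubset x w)"

text \<open>
  \<open>Vset\<close> is unspecified away from the ordinals, so it is not visibly definable. \<open>Vrec\<close> is a definable
  class function that agrees with it on the ordinals.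
\<close>

definition Vrec :: "'v::zfc \<Rightarrow> 'v" where
  "Vrec = ordrec Vstep"

lemma small_Vstep: "small (\<lambda>x. \<exists>\<gamma> w. opair \<gamma> w \<in>\<^sub>V h \<and> vsubset x (w :: 'v::zfc))"
proof (rule small_sep)
  show "dfn (\<lambda>v. \<exists>\<gamma> w. opair \<gamma> w \<in>\<^sub>V h \<and> vsubset (v 0) (w :: 'v))" by (intro dfn_set_rules)
next
  fix x assume "\<exists>\<gamma> w. opair \<gamma> w \<in>\<^sub>V h \<and> vsubset x w"
  then have "vsubset x (vUnion (vUnion (vUnion h)))"
    using opair_mem_vUnion mem_vUnion unfolding vsubset_def by metis
  then show "x \<in>\<^sub>V the_set (\<lambda>x. vsubset x (vUnion (vUnion (vUnion h))))"
    by (simp add: mem_the_set[OF small_Pow])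
qed

lemma dfnt_Vstep: "dfnt (\<lambda>v. Vstep (v 0))"
  unfolding Vstep_def by (intro dfnt_the_set dfn_set_rules small_Vstep)

lemma dfnt_Vrec: "dfnt s \<Longrightarrow> dfnt (\<lambda>v. Vrec (s v))"
  unfolding Vrec_def by (rule dfnt_comp1[OF dfnt_ordrec[OF dfnt_Vstep]])

lemma mem_Vrec:
  assumes "Ord \<alpha>"
  shows "x \<in>\<^sub>V Vrec \<alpha> \<longleftrightarrow> (\<exists>\<gamma>. \<gamma> \<in>\<^sub>V \<alpha> \<and> vsubset x (Vrec \<gamma>))"
proof -
  have "Vrec \<alpha> = Vstep (restr Vrec \<alpha>)"
    unfolding Vrec_def by (rule ordrec_rec[OF dfnt_Vstep assms])
  then have "x \<in>\<^sub>V Vrec \<alpha> \<longleftrightarrow> (\<exists>\<gamma> w. opair \<gamma> w \<in>\<^sub>V restr Vrec \<alpha> \<and> vsubset x w)"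
    by (simp add: Vstep_def mem_the_set[OF small_Vstep])
  then show ?thesis by (auto simp: opair_mem_restr[OF dfnt_Vrec[OF dfnt_var]])
qed

lemma Vrec_mono:
  assumes "Ord \<alpha>" "\<beta> \<in>\<^sub>V vsucc \<alpha>"
  shows "vsubset (Vrec \<beta>) (Vrec \<alpha>)"
proof -
  have "Ord \<beta>" "\<And>\<gamma>. \<gamma> \<in>\<^sub>V \<beta> \<Longrightarrow> \<gamma> \<in>\<^sub>V \<alpha>"
    using assms Ord_mem Ord_trans unfolding mem_vsucc by blast+
  then show ?thesis unfolding vsubset_def mem_Vrec[OF assms(1)] mem_Vrec[OF \<open>Ord \<beta>\<close>] by blast
qed

lemma mem_Vrec_vsucc:
  assumes "Ord \<alpha>"
  shows "x \<in>\<^sub>V Vrec (vsucc \<alpha>) \<longleftrightarrow> vsubset x (Vrec \<alpha>)"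
  unfolding mem_Vrec[OF Ord_vsucc[OF assms]]
  using Vrec_mono[OF assms] unfolding vsubset_def by (metis mem_vsucc)

lemma Vrec_transitive:
  assumes "Ord \<alpha>" "x \<in>\<^sub>V Vrec \<alpha>" "y \<in>\<^sub>V x"
  shows "y \<in>\<^sub>V Vrec \<alpha>"
proof -
  obtain \<gamma> where \<gamma>: "\<gamma> \<in>\<^sub>V \<alpha>" "vsubset x (Vrec \<gamma>)" using assms mem_Vrec by blast
  then show ?thesis
    using Vrec_mono[OF assms(1), of \<gamma>] assms(3) unfolding vsubset_def mem_vsucc by blast
qed

lemma Vset_eq_Vrec:
  assumes "Ord \<alpha>"
  shows "Vset \<alpha> = Vrec \<alpha>"
  unfolding Vset_def
proof (rule the_equality)
  note D = dfnt_Vrec[OF dfnt_var, of 0]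
  let ?f = "restr Vrec (vsucc \<alpha>)"
  let ?B = "the_set (\<lambda>y. \<exists>x. x \<in>\<^sub>V vsucc \<alpha> \<and> y = Vrec x)"
  have "is_fun ?f (vsucc \<alpha>) ?B"
    unfolding is_fun_def mem_restr[OF D] mem_the_set[OF small_image[OF D]]
    by (auto simp: opair_inject)
  moreover have "x \<in>\<^sub>V u \<longleftrightarrow> (\<exists>\<gamma> w. \<gamma> \<in>\<^sub>V \<beta> \<and> opair \<gamma> w \<in>\<^sub>V ?f \<and> vsubset x w)"
    if "opair \<beta> u \<in>\<^sub>V ?f" for \<beta> u x
  proof -
    have "\<beta> \<in>\<^sub>V vsucc \<alpha>" and [simp]: "u = Vrec \<beta>"
      using that unfolding opair_mem_restr[OF D] by auto
    then have "Ord \<beta>" "\<And>\<gamma>. \<gamma> \<in>\<^sub>V \<beta> \<Longrightarrow> \<gamma> \<in>\<^sub>V vsucc \<alpha>"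
      using Ord_vsucc[OF assms] Ord_mem Ord_trans by blast+
    then show ?thesis by (auto simp: opair_mem_restr[OF D] mem_Vrec)
  qed
  moreover have "opair \<alpha> (Vrec \<alpha>) \<in>\<^sub>V ?f"
    by (simp add: opair_mem_restr[OF D] mem_vsucc)
  ultimately show "\<exists>f B. is_fun f (vsucc \<alpha>) B \<and>
     (\<forall>\<beta> u. opair \<beta> u \<in>\<^sub>V f \<longrightarrow>
        (\<forall>x. x \<in>\<^sub>V u \<longleftrightarrow> (\<exists>\<gamma> w. \<gamma> \<in>\<^sub>V \<beta> \<and> opair \<gamma> w \<in>\<^sub>V f \<and> vsubset x w))) \<and>
     opair \<alpha> (Vrec \<alpha>) \<in>\<^sub>V f" by blast
next
  fix v
  assume "\<exists>f B. is_fun f (vsucc \<alpha>) B \<and>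
     (\<forall>\<beta> u. opair \<beta> u \<in>\<^sub>V f \<longrightarrow>
        (\<forall>x. x \<in>\<^sub>V u \<longleftrightarrow> (\<exists>\<gamma> w. \<gamma> \<in>\<^sub>V \<beta> \<and> opair \<gamma> w \<in>\<^sub>V f \<and> vsubset x w))) \<and>
     opair \<alpha> v \<in>\<^sub>V f"
  then obtain f B where f: "is_fun f (vsucc \<alpha>) B"
    and rec: "\<And>\<beta> u x. opair \<beta> u \<in>\<^sub>V f \<Longrightarrow>
        x \<in>\<^sub>V u \<longleftrightarrow> (\<exists>\<gamma> w. \<gamma> \<in>\<^sub>V \<beta> \<and> opair \<gamma> w \<in>\<^sub>V f \<and> vsubset x w)"
    and v: "opair \<alpha> v \<in>\<^sub>V f" by blast
  have "\<forall>u. opair \<alpha> u \<in>\<^sub>V f \<longrightarrow> u = Vrec \<alpha>"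
  proof (rule Ord_induct_dfn[where P="\<lambda>\<beta>. \<forall>u. opair \<beta> u \<in>\<^sub>V f \<longrightarrow> u = Vrec \<beta>"])
    show "dfn (\<lambda>v. \<forall>u. opair (v 0) u \<in>\<^sub>V f \<longrightarrow> u = Vrec (v 0))"
      by (intro dfn_set_rules dfnt_Vrec)
  next
    fix \<beta> assume "Ord \<beta>" and IH: "\<And>\<gamma>. \<gamma> \<in>\<^sub>V \<beta> \<Longrightarrow> \<forall>u. opair \<gamma> u \<in>\<^sub>V f \<longrightarrow> u = Vrec \<gamma>"
    show "\<forall>u. opair \<beta> u \<in>\<^sub>V f \<longrightarrow> u = Vrec \<beta>"
    proof (intro allI impI extensionality)
      fix u x assume u: "opair \<beta> u \<in>\<^sub>V f"
      then have "\<beta> \<in>\<^sub>V vsucc \<alpha>" using f unfolding is_fun_def by (metis opair_inject)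
      then have "\<exists>w. opair \<gamma> w \<in>\<^sub>V f" if "\<gamma> \<in>\<^sub>V \<beta>" for \<gamma>
        using f that Ord_trans[OF Ord_vsucc[OF assms]] unfolding is_fun_def by blast
      then show "x \<in>\<^sub>V u \<longleftrightarrow> x \<in>\<^sub>V Vrec \<beta>"
        unfolding rec[OF u] mem_Vrec[OF \<open>Ord \<beta>\<close>] using IH by metis
    qed
  qed (rule assms)
  then show "v = Vrec \<alpha>" using v by blast
qed

text \<open>
  Iterate the union operation by recursion on the ordinals and collect the values at the elements of
  an inductive set: what is added at \<open>\<alpha>\<close> has its elements added at the successor of \<open>\<alpha>\<close>.
\<close>

lemma ex_transitive_superset:
  "\<exists>t. transitive_set t \<and> vsubset x (t :: 'v::zfc)"
proof -
  define G where "G h = the_set (\<lambda>z. z \<in>\<^sub>V x \<or> (\<exists>\<gamma> w y. opair \<gamma> w \<in>\<^sub>V h \<and> y \<in>\<^sub>V w \<and> z \<in>\<^sub>V y))"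
    for h
  have small: "small (\<lambda>z. z \<in>\<^sub>V x \<or> (\<exists>\<gamma> w y. opair \<gamma> w \<in>\<^sub>V h \<and> y \<in>\<^sub>V w \<and> z \<in>\<^sub>V y))" for h
  proof (rule small_sep)
    show "dfn (\<lambda>v. v 0 \<in>\<^sub>V x \<or> (\<exists>\<gamma> w y. opair \<gamma> w \<in>\<^sub>V h \<and> y \<in>\<^sub>V w \<and> v 0 \<in>\<^sub>V y))"
      by (intro dfn_set_rules)
  next
    fix z assume "z \<in>\<^sub>V x \<or> (\<exists>\<gamma> w y. opair \<gamma> w \<in>\<^sub>V h \<and> y \<in>\<^sub>V w \<and> z \<in>\<^sub>V y)"
    then show "z \<in>\<^sub>V the_set (\<lambda>z. z \<in>\<^sub>V x \<or> z \<in>\<^sub>V vUnion (vUnion (vUnion (vUnion h))))"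
      unfolding mem_the_set[OF small_Un] using opair_mem_vUnion mem_vUnion by metis
  qed
  have G: "dfnt (\<lambda>v. G (v 0))"
    unfolding G_def by (intro dfnt_the_set dfn_set_rules small)
  define T where "T = ordrec G"
  have T: "dfnt (\<lambda>v. T (v 0))" unfolding T_def by (rule dfnt_ordrec[OF G])
  have mem_T: "z \<in>\<^sub>V T \<alpha> \<longleftrightarrow> z \<in>\<^sub>V x \<or> (\<exists>\<gamma> y. \<gamma> \<in>\<^sub>V \<alpha> \<and> y \<in>\<^sub>V T \<gamma> \<and> z \<in>\<^sub>V y)" if "Ord \<alpha>" for \<alpha> z
  proof -
    have "T \<alpha> = G (restr T \<alpha>)" unfolding T_def by (rule ordrec_rec[OF G that])
    then show ?thesis
      using mem_the_set[OF small, of z "restr T \<alpha>"] unfolding opair_mem_restr[OF T] G_def by auto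
  qed
  obtain I e :: 'v where e: "e \<in>\<^sub>V I" "\<forall>z. \<not> z \<in>\<^sub>V e"
    and I: "\<And>y. y \<in>\<^sub>V I \<Longrightarrow> \<exists>s. s \<in>\<^sub>V I \<and> (\<forall>z. z \<in>\<^sub>V s \<longleftrightarrow> z \<in>\<^sub>V y \<or> z = y)"
    using infinity by blast
  have "Ord e" using e(2) unfolding Ord_def transitive_set_def by blast
  have I': "vsucc y \<in>\<^sub>V I" if "y \<in>\<^sub>V I" for y
  proof -
    obtain s where "s \<in>\<^sub>V I" "\<forall>z. z \<in>\<^sub>V s \<longleftrightarrow> z \<in>\<^sub>V y \<or> z = y" using I[OF \<open>y \<in>\<^sub>V I\<close>] by blast
    moreover then have "s = vsucc y" by (intro extensionality) (simp add: mem_vsucc)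
    ultimately show ?thesis by simp
  qed
  have "small (\<lambda>\<alpha>. \<alpha> \<in>\<^sub>V I \<and> Ord \<alpha>)"
    by (rule small_sep[where a=I]) (intro dfn_set_rules dfn_Ord, simp)
  then obtain J where J: "\<And>\<alpha>. \<alpha> \<in>\<^sub>V J \<longleftrightarrow> \<alpha> \<in>\<^sub>V I \<and> Ord \<alpha>" unfolding small_def by blast
  obtain t where t: "\<And>z. z \<in>\<^sub>V t \<longleftrightarrow> (\<exists>\<alpha>. (\<alpha> \<in>\<^sub>V I \<and> Ord \<alpha>) \<and> z \<in>\<^sub>V T \<alpha>)"
    using small_UN[OF T, of J] unfolding small_def J by blast
  have "z \<in>\<^sub>V T (vsucc \<alpha>)" if "Ord \<alpha>" "y \<in>\<^sub>V T \<alpha>" "z \<in>\<^sub>V y" for \<alpha> y z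
    unfolding mem_T[OF Ord_vsucc[OF that(1)]] using that(2,3) mem_vsucc by blast
  then have "transitive_set t" unfolding transitive_set_def t using I' Ord_vsucc by blast
  moreover have "vsubset x t"
    unfolding vsubset_def t using \<open>Ord e\<close> e(1) mem_T by blast
  ultimately show ?thesis by blast
qed

text \<open>
  The empty set serves as default, so that for definable \<open>P\<close> the description always succeeds and depends
  definably on the parameters of \<open>P\<close>.
\<close>

definition least_ord :: "('v::zfc \<Rightarrow> bool) \<Rightarrow> 'v" where
  "least_ord P = (THE \<alpha>. (Ord \<alpha> \<and> P \<alpha> \<and> (\<forall>\<beta>. \<beta> \<in>\<^sub>V \<alpha> \<longrightarrow> \<not> P \<beta>)) \<or>
     (\<not> (\<exists>\<alpha>. Ord \<alpha> \<and> P \<alpha>) \<and> (\<forall>z. \<not> z \<in>\<^sub>V \<alpha>)))"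

lemma ex_empty: "\<exists>e :: 'v::zfc. \<forall>z. \<not> z \<in>\<^sub>V e"
  using infinity by blast

lemma least_ord_ex1:
  assumes "dfn (\<lambda>v. P (v 0))"
  shows "\<exists>!\<alpha> :: 'v::zfc. (Ord \<alpha> \<and> P \<alpha> \<and> (\<forall>\<beta>. \<beta> \<in>\<^sub>V \<alpha> \<longrightarrow> \<not> P \<beta>)) \<or>
     (\<not> (\<exists>\<alpha>. Ord \<alpha> \<and> P \<alpha>) \<and> (\<forall>z. \<not> z \<in>\<^sub>V \<alpha>))"
proof (cases "\<exists>\<alpha>. Ord \<alpha> \<and> P \<alpha>")
  case True
  then obtain \<beta> where "Ord \<beta>" "P \<beta>" "\<forall>\<gamma>. \<gamma> \<in>\<^sub>V \<beta> \<longrightarrow> \<not> P \<gamma>" using Ord_least[OF assms] by blast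
  then show ?thesis using True Ord_linear by blast
next
  case False
  obtain e :: 'v where e: "\<forall>z. \<not> z \<in>\<^sub>V e" using ex_empty by blast
  show ?thesis
  proof (rule ex1I[of _ e])
    fix \<alpha> assume "(Ord \<alpha> \<and> P \<alpha> \<and> (\<forall>\<beta>. \<beta> \<in>\<^sub>V \<alpha> \<longrightarrow> \<not> P \<beta>)) \<or>
     (\<not> (\<exists>\<alpha>. Ord \<alpha> \<and> P \<alpha>) \<and> (\<forall>z. \<not> z \<in>\<^sub>V \<alpha>))"
    then show "\<alpha> = e" using e False by (intro extensionality) blast
  qed (use e False in blast)
qed

lemma least_ord:
  assumes "dfn (\<lambda>v. P (v 0))" "Ord \<alpha>" "P \<alpha>"
  shows "Ord (least_ord P)" "P (least_ord P)" "\<And>\<beta>. \<beta> \<in>\<^sub>V least_ord P \<Longrightarrow> \<not> P (\<beta> :: 'v::zfc)"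
  using theI'[OF least_ord_ex1[OF assms(1)], folded least_ord_def] assms(2,3) by blast+

lemma dfnt_least_ord:
  assumes "dfn (\<lambda>v. P (\<lambda>i. v (Suc i)) (v 0))" "\<And>v. dfn (\<lambda>u. P v (u 0))"
  shows "dfnt (\<lambda>v. least_ord (\<lambda>x. P v x :: bool))"
proof -
  have *: "dfn (\<lambda>v. P (\<lambda>i. v (Suc (Suc i))) (v 0))"
    using dfn_reindex[OF assms(1), of "case_nat 0 (Suc \<circ> Suc)"] by simp
  show ?thesis
    unfolding least_ord_def
    by (intro dfnt_the least_ord_ex1[OF assms(2)] dfn_set_rules dfn_Ord assms(1) *)
qed

definition vrank :: "'v::zfc \<Rightarrow> 'v" where
  "vrank x = least_ord (\<lambda>\<alpha>. vsubset x (Vrec \<alpha>))"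

lemma dfnt_vrank: "dfnt s \<Longrightarrow> dfnt (\<lambda>v. vrank (s v))"
  by (rule dfnt_comp1[where F=vrank])
    (unfold vrank_def, intro dfnt_least_ord dfn_set_rules dfnt_Vrec)

lemma dfn_subset_Vrec: "dfn (\<lambda>v. vsubset x (Vrec (v 0)))"
  by (intro dfn_set_rules dfnt_Vrec)

text \<open>
  An \<open>\<in>\<^sub>V\<close>-minimal set outside the hierarchy, found inside a transitive set, would have all its
  elements in the hierarchy, and hence be contained in the stage indexed by the supremum of their
  ranks.
\<close>

lemma ex_subset_Vrec: "\<exists>\<alpha>. Ord \<alpha> \<and> vsubset x (Vrec \<alpha>)"
proof (rule ccontr)
  let ?bad = "\<lambda>y. \<not> (\<exists>\<alpha>. Ord \<alpha> \<and> vsubset y (Vrec \<alpha>))"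
  assume "?bad x"
  obtain t where t: "transitive_set t" "vsubset (upair x x) t" using ex_transitive_superset by blast
  have "dfn (\<lambda>v. ?bad (v 0))" by (intro dfn_set_rules dfn_Ord dfnt_Vrec)
  moreover have "x \<in>\<^sub>V t" using t(2) unfolding vsubset_def mem_upair by blast
  ultimately obtain m where m: "m \<in>\<^sub>V t" "?bad m" "\<And>y. y \<in>\<^sub>V t \<Longrightarrow> ?bad y \<Longrightarrow> \<not> y \<in>\<^sub>V m"
    using ex_minimal[where P="?bad", of x t] \<open>?bad x\<close> by blast
  have good: "Ord (vrank y)" "vsubset y (Vrec (vrank y))" if y: "y \<in>\<^sub>V m" for y
  proof -
    have "\<not> ?bad y" using m t(1) y unfolding transitive_set_def by blast
    then obtain \<alpha> where "Ord \<alpha>" "vsubset y (Vrec \<alpha>)" by blast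
    from least_ord[OF dfn_subset_Vrec this]
    show "Ord (vrank y)" "vsubset y (Vrec (vrank y))" unfolding vrank_def by blast+
  qed
  have D: "dfnt (\<lambda>v. vsucc (vsucc (vrank (v 0))))" by (intro dfn_set_rules dfnt_vrank)
  define A where "A = the_set (\<lambda>\<alpha>. \<exists>y. y \<in>\<^sub>V m \<and> \<alpha> = vsucc (vsucc (vrank y)))"
  have A: "\<alpha> \<in>\<^sub>V A \<longleftrightarrow> (\<exists>y. y \<in>\<^sub>V m \<and> \<alpha> = vsucc (vsucc (vrank y)))" for \<alpha>
    unfolding A_def by (rule mem_the_set[OF small_image[OF D]])
  have "Ord (vUnion A)" by (rule Ord_vUnion) (auto simp: A good Ord_vsucc)
  moreover have "y \<in>\<^sub>V Vrec (vUnion A)" if "y \<in>\<^sub>V m" for y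
  proof -
    have "vsucc (vrank y) \<in>\<^sub>V vUnion A" unfolding mem_vUnion A using that mem_vsucc by blast
    then have "vsubset (Vrec (vsucc (vrank y))) (Vrec (vUnion A))"
      using Vrec_mono \<open>Ord (vUnion A)\<close> unfolding mem_vsucc by blast
    then show ?thesis
      using mem_Vrec_vsucc good[OF that] unfolding vsubset_def by blast
  qed
  ultimately show False using m(2) unfolding vsubset_def by blast
qed

lemma vrank:
  shows "Ord (vrank x)" "vsubset x (Vrec (vrank x))"
    "\<And>\<beta>. \<beta> \<in>\<^sub>V vrank x \<Longrightarrow> \<not> vsubset x (Vrec \<beta>)"
proof -
  obtain \<alpha> where "Ord \<alpha>" "vsubset x (Vrec \<alpha>)" using ex_subset_Vrec by blast
  note * = least_ord[OF dfn_subset_Vrec this, folded vrank_def]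
  show "Ord (vrank x)" "vsubset x (Vrec (vrank x))"
    "\<And>\<beta>. \<beta> \<in>\<^sub>V vrank x \<Longrightarrow> \<not> vsubset x (Vrec \<beta>)" by (rule *; assumption)+
qed

text \<open>
  The rank is defined with membership in the stage after \<open>\<alpha>\<close>, which is the power set of stage \<open>\<alpha>\<close>.
\<close>

lemma rank_eq_vrank: "rank x = vrank x"
  unfolding rank_def
proof (rule the_equality)
  have V: "x \<in>\<^sub>V Vset (vsucc \<alpha>) \<longleftrightarrow> vsubset x (Vrec \<alpha>)" if "Ord \<alpha>" for \<alpha>
    by (simp add: Vset_eq_Vrec[OF Ord_vsucc[OF that]] mem_Vrec_vsucc[OF that])
  show *: "Ord (vrank x) \<and> x \<in>\<^sub>V Vset (vsucc (vrank x)) \<and>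
     (\<forall>\<beta>. Ord \<beta> \<longrightarrow> x \<in>\<^sub>V Vset (vsucc \<beta>) \<longrightarrow> \<beta> = vrank x \<or> vrank x \<in>\<^sub>V \<beta>)"
    using vrank(1,2)[of x] vrank(3)[of _ x] V Ord_linear by blast
  fix \<alpha>
  assume "Ord \<alpha> \<and> x \<in>\<^sub>V Vset (vsucc \<alpha>) \<and>
     (\<forall>\<beta>. Ord \<beta> \<longrightarrow> x \<in>\<^sub>V Vset (vsucc \<beta>) \<longrightarrow> \<beta> = \<alpha> \<or> \<alpha> \<in>\<^sub>V \<beta>)"
  then show "\<alpha> = vrank x" using * mem_asym by blast
qed

lemma vrank_mem:
  assumes "Ord \<alpha>" "x \<in>\<^sub>V Vrec \<alpha>"
  shows "vrank x \<in>\<^sub>V \<alpha>"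
proof -
  obtain \<gamma> where \<gamma>: "\<gamma> \<in>\<^sub>V \<alpha>" "vsubset x (Vrec \<gamma>)" using assms mem_Vrec by blast
  then have "vrank x \<in>\<^sub>V \<gamma> \<or> vrank x = \<gamma>"
    using vrank(1)[of x] vrank(3)[of \<gamma> x] Ord_linear[of "vrank x" \<gamma>] Ord_mem[OF assms(1)]
    by blast
  then show ?thesis using \<gamma>(1) assms(1) Ord_trans by blast
qed

lemma vrank_mono: "y \<in>\<^sub>V x \<Longrightarrow> vrank y \<in>\<^sub>V vrank x"
  using vrank_mem[OF vrank(1)] vrank(2) unfolding vsubset_def by blast

section \<open>Well-ordering\<close>

lemma ex_choice_function:
  fixes Y :: "'v::zfc"
  shows "\<exists>ch. dfnt (\<lambda>v. ch (v 0)) \<and> (\<forall>s y. vsubset s Y \<longrightarrow> y \<in>\<^sub>V s \<longrightarrow> ch s \<in>\<^sub>V s)"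
proof -
  \<comment> \<open>The sets \<open>{s} \<times> s\<close> are disjoint, so a transversal of them picks an element of every \<open>s\<close>.\<close>
  define K where "K s = the_set (\<lambda>p. \<exists>z. z \<in>\<^sub>V s \<and> p = opair s z)" for s :: 'v
  have sK: "small (\<lambda>p. \<exists>z. z \<in>\<^sub>V s \<and> p = opair s z)" for s :: 'v
    by (rule small_image) (intro dfn_set_rules)
  have K: "p \<in>\<^sub>V K s \<longleftrightarrow> (\<exists>z. z \<in>\<^sub>V s \<and> p = opair s z)" for p s
    unfolding K_def by (rule mem_the_set[OF sK])
  have dK: "dfnt (\<lambda>v. K (v 0))" unfolding K_def by (intro dfnt_the_set dfn_set_rules sK)
  let ?ok = "\<lambda>s. vsubset s Y \<and> (\<exists>y. y \<in>\<^sub>V s)"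
  have "small ?ok"
    by (rule small_sep[where a="the_set (\<lambda>s. vsubset s Y)"])
      (intro dfn_set_rules, simp add: mem_the_set[OF small_Pow])
  then obtain D where D: "\<And>s. s \<in>\<^sub>V D \<longleftrightarrow> ?ok s" unfolding small_def by blast
  define fam where "fam = the_set (\<lambda>k. \<exists>s. s \<in>\<^sub>V D \<and> k = K s)"
  have fam: "k \<in>\<^sub>V fam \<longleftrightarrow> (\<exists>s. ?ok s \<and> k = K s)" for k
    unfolding fam_def mem_the_set[OF small_image[OF dK]] by (simp only: D)
  have "\<exists>c. \<forall>y. y \<in>\<^sub>V fam \<longrightarrow> (\<exists>!z. z \<in>\<^sub>V y \<and> z \<in>\<^sub>V c)"
  proof (rule transversal)
    fix y assume "y \<in>\<^sub>V fam"
    then obtain s where s: "?ok s \<and> y = K s" unfolding fam by (elim exE)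
    then obtain a where "a \<in>\<^sub>V s" by (elim conjE exE)
    then have "opair s a \<in>\<^sub>V y" by (auto simp: s K)
    then show "\<exists>z. z \<in>\<^sub>V y" ..
    fix y' z assume "y' \<in>\<^sub>V fam" and z: "z \<in>\<^sub>V y" "z \<in>\<^sub>V y'"
    then obtain s' where s': "?ok s' \<and> y' = K s'" unfolding fam by (elim exE)
    with z s have "s = s'" by (auto simp: K opair_inject)
    then show "y = y'" using s s' by simp
  qed
  then obtain c where c: "\<forall>y. y \<in>\<^sub>V fam \<longrightarrow> (\<exists>!z. z \<in>\<^sub>V y \<and> z \<in>\<^sub>V c)" by (elim exE)
  have c': "\<exists>!z. z \<in>\<^sub>V s \<and> opair s z \<in>\<^sub>V c" if s: "?ok s" for s
  proof -
    have "K s \<in>\<^sub>V fam" unfolding fam by (rule exI[of _ s]) (use s in simp)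
    then have ex1: "\<exists>!p. p \<in>\<^sub>V K s \<and> p \<in>\<^sub>V c" using c by simp
    then obtain p where p: "p \<in>\<^sub>V K s \<and> p \<in>\<^sub>V c" by (elim ex1_implies_ex[THEN exE])
    then obtain z where z: "z \<in>\<^sub>V s" "p = opair s z" by (auto simp: K)
    show ?thesis
    proof (rule ex1I[of _ z])
      show "z \<in>\<^sub>V s \<and> opair s z \<in>\<^sub>V c" using z p by simp
      fix w assume "w \<in>\<^sub>V s \<and> opair s w \<in>\<^sub>V c"
      then have "opair s w = p" using the1_equality[OF ex1, of "opair s w"] the1_equality[OF ex1 p] by (simp add: K opair_inject)
      then show "w = z" using z(2) by (simp add: opair_inject)
    qed
  qed
  let ?Q = "\<lambda>s z. (?ok s \<and> z \<in>\<^sub>V s \<and> opair s z \<in>\<^sub>V c) \<or> (\<not> ?ok s \<and> z = s)"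
  have ex1: "\<exists>!z. ?Q s z" for s
  proof (cases "?ok s")
    case True
    then show ?thesis using c'[OF True] by simp
  next
    case False
    then show ?thesis by (intro ex1I[of _ s]) blast+
  qed
  have "dfnt (\<lambda>v. THE z. ?Q (v 0) z)" by (rule dfnt_the[OF _ ex1]) (intro dfn_set_rules)
  moreover have "(THE z. ?Q s z) \<in>\<^sub>V s" if "vsubset s Y" "y \<in>\<^sub>V s" for s y
    using theI'[OF ex1[of s]] that by blast
  ultimately show ?thesis by (intro exI[of _ "\<lambda>s. THE z. ?Q s z"]) blast
qed

text \<open>
  Enumerate \<open>Y\<close> by choosing at each stage an element that has not yet been listed. If this never
  exhausted \<open>Y\<close>, it would embed the class of ordinals in \<open>Y\<close>.
\<close>

theorem well_ordering:
  fixes Y :: "'v::zfc"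
  shows "\<exists>\<alpha> e. Ord \<alpha> \<and> dfnt (\<lambda>v. e (v 0)) \<and> (\<forall>y. y \<in>\<^sub>V Y \<longrightarrow> (\<exists>\<beta>. \<beta> \<in>\<^sub>V \<alpha> \<and> y = e \<beta>))"
proof -
  obtain ch where ch: "dfnt (\<lambda>v. ch (v 0))"
    "\<And>s y. vsubset s Y \<Longrightarrow> y \<in>\<^sub>V s \<Longrightarrow> ch s \<in>\<^sub>V s"
    using ex_choice_function[of Y] by blast
  define rest where "rest h = the_set (\<lambda>z. z \<in>\<^sub>V Y \<and> \<not> (\<exists>\<gamma>. opair \<gamma> z \<in>\<^sub>V h))" for h
  have s: "small (\<lambda>z. z \<in>\<^sub>V Y \<and> \<not> (\<exists>\<gamma>. opair \<gamma> z \<in>\<^sub>V h))" for h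
    by (rule small_sep[where a=Y]) (intro dfn_set_rules, simp)
  have G: "dfnt (\<lambda>v. ch (rest (v 0)))"
    unfolding rest_def by (intro dfnt_comp1[OF ch(1)] dfnt_the_set dfn_set_rules s)
  define e where "e = ordrec (\<lambda>h. ch (rest h))"
  have e: "dfnt (\<lambda>v. e (v 0))" unfolding e_def by (rule dfnt_ordrec[OF G])
  have new: "e \<alpha> \<in>\<^sub>V Y \<and> \<not> (\<exists>\<gamma>. \<gamma> \<in>\<^sub>V \<alpha> \<and> e \<alpha> = e \<gamma>)"
    if "Ord \<alpha>" "y \<in>\<^sub>V Y" "\<not> (\<exists>\<gamma>. \<gamma> \<in>\<^sub>V \<alpha> \<and> y = e \<gamma>)" for \<alpha> y
  proof -
    have rest: "z \<in>\<^sub>V rest (restr e \<alpha>) \<longleftrightarrow> z \<in>\<^sub>V Y \<and> \<not> (\<exists>\<gamma>. \<gamma> \<in>\<^sub>V \<alpha> \<and> z = e \<gamma>)" for z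
      using mem_the_set[OF s, of z "restr e \<alpha>"]
      unfolding rest_def[symmetric] unfolding opair_mem_restr[OF e] .
    have "e \<alpha> = ch (rest (restr e \<alpha>))" unfolding e_def by (rule ordrec_rec[OF G that(1)])
    moreover have "ch (rest (restr e \<alpha>)) \<in>\<^sub>V rest (restr e \<alpha>)"
      using ch(2)[of "rest (restr e \<alpha>)" y] that rest unfolding vsubset_def by blast
    ultimately show ?thesis using rest by simp
  qed
  have "\<exists>\<alpha>. Ord \<alpha> \<and> (\<forall>y. y \<in>\<^sub>V Y \<longrightarrow> (\<exists>\<beta>. \<beta> \<in>\<^sub>V \<alpha> \<and> y = e \<beta>))"
  proof (rule ccontr)
    assume "\<not> ?thesis"
    then have e': "e \<alpha> \<in>\<^sub>V Y" "\<And>\<gamma>. \<gamma> \<in>\<^sub>V \<alpha> \<Longrightarrow> e \<alpha> \<noteq> e \<gamma>" if "Ord \<alpha>" for \<alpha>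
      using that new by meson+
    define i where "i y = least_ord (\<lambda>\<alpha>. e \<alpha> = y)" for y
    have P: "dfn (\<lambda>v. e (v 0) = y)" for y by (intro dfn_set_rules dfnt_comp1[OF e])
    have i: "dfnt (\<lambda>v. i (v 0))"
      unfolding i_def by (intro dfnt_least_ord dfn_set_rules dfnt_comp1[OF e])
    have "i (e \<alpha>) = \<alpha>" if "Ord \<alpha>" for \<alpha>
      using least_ord[OF P that refl] e'(2)[OF that] e'(2)[of "least_ord (\<lambda>\<beta>. e \<beta> = e \<alpha>)"]
        Ord_linear[OF that] unfolding i_def by metis
    then have "\<exists>y. y \<in>\<^sub>V Y \<and> \<alpha> = i y" if "Ord \<alpha>" for \<alpha> using that e'(1) by metis
    then have "\<alpha> \<in>\<^sub>V the_set (\<lambda>\<alpha>. \<exists>y. y \<in>\<^sub>V Y \<and> \<alpha> = i y)" if "Ord \<alpha>" for \<alpha>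
      unfolding mem_the_set[OF small_image[OF i]] using that by blast
    then have "small (Ord :: 'v \<Rightarrow> bool)"
      by (intro small_sep[where P=Ord]) (intro dfn_Ord dfnt_var, blast)
    then show False using Ord_not_small by blast
  qed
  then show ?thesis using e by blast
qed

section \<open>Predicates with the same meaning in all transitive classes\<close>

definition transitive_class :: "'v::membership set \<Rightarrow> bool" where
  "transitive_class N \<longleftrightarrow> (\<forall>x y. x \<in> N \<longrightarrow> y \<in>\<^sub>V x \<longrightarrow> y \<in> N)"

text \<open>
  \<open>Q N v\<close> is the value that one formula takes in every transitive class \<open>N\<close>. \<open>Q\<close>
  mentions \<open>N\<close> on account of unbounded quantifiers, so a \<open>Q\<close> that ignores \<open>N\<close> is an absolute predicate.
\<close>

definition expr :: "('v::membership set \<Rightarrow> (nat \<Rightarrow> 'v) \<Rightarrow> bool) \<Rightarrow> bool" where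
  "expr Q \<longleftrightarrow> (\<exists>\<phi>. \<forall>N v. transitive_class N \<longrightarrow> range v \<subseteq> N \<longrightarrow> (sat N \<phi> v \<longleftrightarrow> Q N v))"

lemma exprI:
  assumes "\<And>N v. transitive_class N \<Longrightarrow> range v \<subseteq> N \<Longrightarrow> sat N \<phi> v \<longleftrightarrow> Q N v"
  shows "expr Q"
  unfolding expr_def by (intro exI[of _ \<phi>] allI impI assms)

lemma exprE:
  assumes "expr Q"
  obtains \<phi> where "\<And>N v. transitive_class N \<Longrightarrow> range v \<subseteq> N \<Longrightarrow> sat N \<phi> v \<longleftrightarrow> Q N v"
  using assms unfolding expr_def by auto

lemma expr_cong:
  assumes "expr Q" "\<And>N v. transitive_class N \<Longrightarrow> range v \<subseteq> N \<Longrightarrow> Q N v \<longleftrightarrow> R N v"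
  shows "expr R"
  by (rule exprE[OF assms(1)], rule exprI) (simp add: assms(2))

lemma expr_mem: "expr (\<lambda>N v. v i \<in>\<^sub>V v k)"
  by (rule exprI[of "FMem i k"]) simp

lemma expr_eq: "expr (\<lambda>N v. v i = v k)"
  by (rule exprI[of "FEq i k"]) simp

lemma expr_not: "expr Q \<Longrightarrow> expr (\<lambda>N v. \<not> Q N v)"
  by (erule exprE, rule exprI[of "FNeg _"]) simp

lemma expr_and:
  assumes "expr Q" "expr R"
  shows "expr (\<lambda>N v. Q N v \<and> R N v)"
proof (rule exprE[OF assms(1)], rule exprE[OF assms(2)])
  fix p q
  assume "\<And>N v. transitive_class N \<Longrightarrow> range v \<subseteq> N \<Longrightarrow> sat N p v \<longleftrightarrow> Q N v"
    and "\<And>N v. transitive_class N \<Longrightarrow> range v \<subseteq> N \<Longrightarrow> sat N q v \<longleftrightarrow> R N v"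
  then show ?thesis by (intro exprI[of "FAnd p q"]) simp
qed

lemma expr_or:
  assumes "expr Q" "expr R"
  shows "expr (\<lambda>N v. Q N v \<or> R N v)"
proof -
  have "expr (\<lambda>N v. \<not> (\<not> Q N v \<and> \<not> R N v))" by (intro expr_not expr_and assms)
  then show ?thesis by simp
qed

lemma expr_imp:
  assumes "expr Q" "expr R"
  shows "expr (\<lambda>N v. Q N v \<longrightarrow> R N v)"
  by (rule expr_cong[OF expr_or[OF expr_not[OF assms(1)] assms(2)]]) blast

lemma expr_iff:
  assumes "expr Q" "expr R"
  shows "expr (\<lambda>N v. Q N v \<longleftrightarrow> R N v)"
  by (rule expr_cong[OF expr_and[OF expr_imp[OF assms] expr_imp[OF assms(2,1)]]]) blast

lemma expr_sat: "expr (\<lambda>N v. sat N \<phi> (\<lambda>i. v (r i)))"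
proof -
  obtain \<phi>' where "\<forall>M v. sat M \<phi>' v \<longleftrightarrow> sat M \<phi> (\<lambda>i. v (r i) :: 'a)"
    using sat_rename[of \<phi> r] by (elim exE)
  then show ?thesis by (intro exprI[of \<phi>']) simp
qed

lemma expr_all_env:
  assumes "expr Q"
  shows "expr (\<lambda>N v. \<forall>x\<in>N. Q N (case_nat x v))"
proof -
  obtain \<phi> where \<phi>: "\<And>N v. transitive_class N \<Longrightarrow> range v \<subseteq> N \<Longrightarrow> sat N \<phi> v \<longleftrightarrow> Q N v"
    using exprE[OF assms] by metis
  obtain \<chi> where \<chi>: "\<forall>M v. sat M \<chi> v \<longleftrightarrow> (\<forall>x\<in>M. sat M \<phi> (case_nat x v :: nat \<Rightarrow> 'a))"
    using sat_all_shifted[of \<phi>] by (elim exE)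
  show ?thesis
  proof (rule exprI[of \<chi>])
    fix N and v :: "nat \<Rightarrow> 'a" assume N: "transitive_class N" and v: "range v \<subseteq> N"
    have "range (case_nat x v) \<subseteq> N" if "x \<in> N" for x using that v by (auto simp: image_subset_iff split: nat.split)
    then show "sat N \<chi> v \<longleftrightarrow> (\<forall>x\<in>N. Q N (case_nat x v))" using \<phi>[OF N] \<chi> by simp
  qed
qed

lemma expr_ex_env:
  assumes "expr Q"
  shows "expr (\<lambda>N v. \<exists>x\<in>N. Q N (case_nat x v))"
  by (rule expr_cong[OF expr_not[OF expr_all_env[OF expr_not[OF assms]]]]) blast

lemma expr_all:
  assumes "expr (\<lambda>N v. Q N (\<lambda>i. v (Suc i)) (v 0))"
  shows "expr (\<lambda>N v. \<forall>x\<in>N. Q N v x)"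
  using expr_all_env[OF assms] by simp

lemma expr_ex:
  assumes "expr (\<lambda>N v. Q N (\<lambda>i. v (Suc i)) (v 0))"
  shows "expr (\<lambda>N v. \<exists>x\<in>N. Q N v x)"
  using expr_ex_env[OF assms] by simp

lemma expr_ball:
  assumes "expr (\<lambda>N v. Q N (\<lambda>i. v (Suc i)) (v 0))"
  shows "expr (\<lambda>N v. \<forall>x. x \<in>\<^sub>V v k \<longrightarrow> Q N v x)"
proof (rule expr_cong)
  show "expr (\<lambda>N v. \<forall>x\<in>N. x \<in>\<^sub>V v k \<longrightarrow> Q N v x)"
    by (intro expr_all expr_imp expr_mem assms)
qed (unfold transitive_class_def image_subset_iff, blast)

lemma expr_bex:
  assumes "expr (\<lambda>N v. Q N (\<lambda>i. v (Suc i)) (v 0))"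
  shows "expr (\<lambda>N v. \<exists>x. x \<in>\<^sub>V v k \<and> Q N v x)"
proof (rule expr_cong)
  show "expr (\<lambda>N v. \<exists>x\<in>N. x \<in>\<^sub>V v k \<and> Q N v x)"
    by (intro expr_ex expr_and expr_mem assms)
qed (unfold transitive_class_def image_subset_iff, blast)

lemmas expr_rules = expr_mem expr_eq expr_not expr_and expr_or expr_ball expr_bex
  expr_imp expr_iff expr_all expr_ex

lemma expr_upair: "expr (\<lambda>N v. v i = upair (v k) (v l))"
proof (rule expr_cong)
  show "expr (\<lambda>N v. v k \<in>\<^sub>V v i \<and> v l \<in>\<^sub>V v i \<and> (\<forall>z. z \<in>\<^sub>V v i \<longrightarrow> z = v k \<or> z = v l))"
    by (intro expr_rules)
qed (simp only: upair_eq_iff)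

lemma expr_opair: "expr (\<lambda>N v. v i = opair (v k) (v l))"
proof (rule expr_cong)
  show "expr (\<lambda>N v. \<exists>x. x \<in>\<^sub>V v i \<and> (\<exists>y. y \<in>\<^sub>V v i \<and>
      v i = upair x y \<and> x = upair (v k) (v k) \<and> y = upair (v k) (v l)))"
    by (intro expr_rules expr_upair)
qed (auto simp: opair_def mem_upair)

lemma expr_opair_mem: "expr (\<lambda>N v. opair (v k) (v l) \<in>\<^sub>V v i)"
proof (rule expr_cong)
  show "expr (\<lambda>N v. \<exists>p. p \<in>\<^sub>V v i \<and> p = opair (v k) (v l))"
    by (intro expr_rules expr_opair)
qed auto

lemma expr_transitive_set: "expr (\<lambda>N v. transitive_set (v i))"
proof (rule expr_cong)
  show "expr (\<lambda>N v. \<forall>y. y \<in>\<^sub>V v i \<longrightarrow> (\<forall>z. z \<in>\<^sub>V y \<longrightarrow> z \<in>\<^sub>V v i))"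
    by (intro expr_rules)
qed (auto simp: transitive_set_def)

lemma expr_Ord: "expr (\<lambda>N v. Ord (v i))"
proof (rule expr_cong)
  show "expr (\<lambda>N v. transitive_set (v i) \<and>
      (\<forall>x. x \<in>\<^sub>V v i \<longrightarrow> (\<forall>y. y \<in>\<^sub>V v i \<longrightarrow> x \<in>\<^sub>V y \<or> x = y \<or> y \<in>\<^sub>V x)))"
    by (intro expr_rules expr_transitive_set)
qed (auto simp: Ord_def)

text \<open>
  Bounding the quantifiers shows that being a function is absolute.
\<close>

lemma is_fun_bounded_iff:
  "is_fun f A B \<longleftrightarrow>
     (\<forall>p. p \<in>\<^sub>V f \<longrightarrow> (\<exists>a. a \<in>\<^sub>V A \<and> (\<exists>b. b \<in>\<^sub>V B \<and> p = opair a b))) \<and>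
     (\<forall>a. a \<in>\<^sub>V A \<longrightarrow> (\<exists>b. b \<in>\<^sub>V B \<and> opair a b \<in>\<^sub>V f \<and>
        (\<forall>c. c \<in>\<^sub>V B \<longrightarrow> opair a c \<in>\<^sub>V f \<longrightarrow> c = b)))" (is "?l \<longleftrightarrow> ?r")
proof
  assume l: ?l
  then have B: "b \<in>\<^sub>V B" if "opair a b \<in>\<^sub>V f" for a b
    using that unfolding is_fun_def by (metis opair_inject)
  show ?r
  proof (intro conjI allI impI)
    fix p assume "p \<in>\<^sub>V f"
    then show "\<exists>a. a \<in>\<^sub>V A \<and> (\<exists>b. b \<in>\<^sub>V B \<and> p = opair a b)"
      using l unfolding is_fun_def by blast
  next
    fix a assume "a \<in>\<^sub>V A"
    then obtain b where "opair a b \<in>\<^sub>V f" "\<And>c. opair a c \<in>\<^sub>V f \<Longrightarrow> c = b"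
      using l unfolding is_fun_def by blast
    then show "\<exists>b. b \<in>\<^sub>V B \<and> opair a b \<in>\<^sub>V f \<and>
        (\<forall>c. c \<in>\<^sub>V B \<longrightarrow> opair a c \<in>\<^sub>V f \<longrightarrow> c = b)" using B by blast
  qed
next
  assume r: ?r
  then have B: "b \<in>\<^sub>V B" if "opair a b \<in>\<^sub>V f" for a b
    using that by (metis opair_inject)
  show ?l unfolding is_fun_def
  proof (intro conjI allI impI)
    fix p assume "p \<in>\<^sub>V f"
    then show "\<exists>a b. a \<in>\<^sub>V A \<and> b \<in>\<^sub>V B \<and> p = opair a b" using r by blast
  next
    fix a assume "a \<in>\<^sub>V A"
    then obtain b where "opair a b \<in>\<^sub>V f" "\<And>c. c \<in>\<^sub>V B \<Longrightarrow> opair a c \<in>\<^sub>V f \<Longrightarrow> c = b"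
      using r by blast
    then show "\<exists>!b. opair a b \<in>\<^sub>V f" using B by blast
  qed
qed

lemma expr_is_fun: "expr (\<lambda>N v. is_fun (v i) (v k) (v l))"
  unfolding is_fun_bounded_iff by (intro expr_rules expr_opair expr_opair_mem)

text \<open>
  The bound \<open>B\<close> on the values serves to make the predicate visibly absolute.
\<close>

definition vinj :: "'v::zfc \<Rightarrow> 'v \<Rightarrow> 'v \<Rightarrow> bool" where
  "vinj f A B \<longleftrightarrow> (\<forall>a. a \<in>\<^sub>V A \<longrightarrow> (\<forall>a'. a' \<in>\<^sub>V A \<longrightarrow> (\<forall>b. b \<in>\<^sub>V B \<longrightarrow>
     opair a b \<in>\<^sub>V f \<and> opair a' b \<in>\<^sub>V f \<longrightarrow> a = a')))"

lemma expr_vinj: "expr (\<lambda>N v. vinj (v i) (v k) (v l))"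
  unfolding vinj_def by (intro expr_rules expr_opair_mem)

text \<open>
  A certificate for \<open>x\<close> having rank below \<open>\<alpha>\<close>. Being a certificate is absolute, whereas the stages
  of the hierarchy are not, as they depend on the power sets of the class where they are formed.
\<close>

definition ranked :: "'v::zfc \<Rightarrow> 'v \<Rightarrow> 'v \<Rightarrow> 'v \<Rightarrow> bool" where
  "ranked x \<alpha> t \<rho> \<longleftrightarrow> transitive_set t \<and> x \<in>\<^sub>V t \<and> is_fun \<rho> t \<alpha> \<and>
     (\<forall>y. y \<in>\<^sub>V t \<longrightarrow> (\<forall>z. z \<in>\<^sub>V y \<longrightarrow> (\<forall>b. b \<in>\<^sub>V \<alpha> \<longrightarrow> (\<forall>c. c \<in>\<^sub>V \<alpha> \<longrightarrow>
        opair y b \<in>\<^sub>V \<rho> \<and> opair z c \<in>\<^sub>V \<rho> \<longrightarrow> c \<in>\<^sub>V b))))"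

lemma expr_ranked: "expr (\<lambda>N v. ranked (v i) (v k) (v l) (v m))"
  unfolding ranked_def by (intro expr_rules expr_opair_mem expr_is_fun expr_transitive_set)

lemma is_fun_opair_mem: "is_fun f A B \<Longrightarrow> opair a b \<in>\<^sub>V f \<Longrightarrow> a \<in>\<^sub>V A \<and> b \<in>\<^sub>V B"
  unfolding is_fun_def by (metis opair_inject)

lemma is_fun_restr:
  assumes "dfnt (\<lambda>v. F (v 0))" "\<And>x. x \<in>\<^sub>V X \<Longrightarrow> F x \<in>\<^sub>V B"
  shows "is_fun (restr F X) X B"
  unfolding is_fun_def using assms(2) by (auto simp: mem_restr[OF assms(1)] opair_inject)

lemma ranked_mono:
  assumes "ranked x \<alpha> t \<rho>" "vsubset \<alpha> \<beta>"
  shows "ranked x \<beta> t \<rho>"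
proof -
  have \<rho>: "is_fun \<rho> t \<alpha>" using assms(1) unfolding ranked_def by blast
  then have "is_fun \<rho> t \<beta>" using assms(2) unfolding is_fun_def vsubset_def by blast
  moreover have "b \<in>\<^sub>V \<alpha>" if "opair y b \<in>\<^sub>V \<rho>" for y b using is_fun_opair_mem[OF \<rho> that] by blast
  ultimately show ?thesis using assms(1) unfolding ranked_def by blast
qed

text \<open>
  A minimal \<open>y\<close> in \<open>t\<close> that is not contained in the stage indexed by its value under \<open>\<rho>\<close> cannot
  exist, since the values of its elements are smaller.
\<close>

lemma ranked_imp_mem_Vrec:
  assumes "Ord \<alpha>" "ranked x \<alpha> t \<rho>"
  shows "x \<in>\<^sub>V Vrec \<alpha>"
proof -
  have t: "transitive_set t" "x \<in>\<^sub>V t" and \<rho>: "is_fun \<rho> t \<alpha>"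
    using assms(2) unfolding ranked_def by blast+
  have less: "c \<in>\<^sub>V b" if "y \<in>\<^sub>V t" "z \<in>\<^sub>V y" "b \<in>\<^sub>V \<alpha>" "c \<in>\<^sub>V \<alpha>"
      "opair y b \<in>\<^sub>V \<rho>" "opair z c \<in>\<^sub>V \<rho>" for y z b c
    using assms(2) that unfolding ranked_def by blast
  let ?P = "\<lambda>y. \<exists>b. opair y b \<in>\<^sub>V \<rho> \<and> \<not> vsubset y (Vrec b)"
  have "\<not> ?P x"
  proof
    assume "?P x"
    moreover have "dfn (\<lambda>v. ?P (v 0))" by (intro dfn_set_rules dfnt_Vrec)
    ultimately obtain m where m: "m \<in>\<^sub>V t" "?P m" and min: "\<And>y. y \<in>\<^sub>V t \<Longrightarrow> ?P y \<Longrightarrow> \<not> y \<in>\<^sub>V m"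
      using ex_minimal[where P="?P", of x t] t(2) by blast
    from m(2) obtain b where b: "opair m b \<in>\<^sub>V \<rho>" "\<not> vsubset m (Vrec b)" by blast
    have b\<alpha>: "b \<in>\<^sub>V \<alpha>" using is_fun_opair_mem[OF \<rho> b(1)] by blast
    have "z \<in>\<^sub>V Vrec b" if "z \<in>\<^sub>V m" for z
    proof -
      have zt: "z \<in>\<^sub>V t" using t(1) m(1) that unfolding transitive_set_def by blast
      then obtain c where c: "opair z c \<in>\<^sub>V \<rho>" using \<rho> unfolding is_fun_def by blast
      have "c \<in>\<^sub>V b"
        using less[OF m(1) that b\<alpha> _ b(1) c] is_fun_opair_mem[OF \<rho> c] by blast
      moreover have "vsubset z (Vrec c)" using min[OF zt] that c by blast
      ultimately show ?thesis using mem_Vrec[OF Ord_mem[OF assms(1) b\<alpha>]] by blast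
    qed
    then show False using b(2) unfolding vsubset_def by blast
  qed
  moreover obtain b where b: "opair x b \<in>\<^sub>V \<rho>" using \<rho> t(2) unfolding is_fun_def by blast
  ultimately have "vsubset x (Vrec b)" by blast
  then show ?thesis
    using mem_Vrec[OF assms(1)] is_fun_opair_mem[OF \<rho> b] by blast
qed

lemma mem_Vrec_imp_ranked:
  assumes "Ord \<alpha>" "x \<in>\<^sub>V Vrec \<alpha>"
  shows "ranked x \<alpha> (Vrec \<alpha>) (restr vrank (Vrec \<alpha>))"
proof -
  note D = dfnt_vrank[OF dfnt_var, of 0]
  have "is_fun (restr vrank (Vrec \<alpha>)) (Vrec \<alpha>) \<alpha>"
    by (intro is_fun_restr D vrank_mem assms(1))
  moreover have "transitive_set (Vrec \<alpha>)"
    unfolding transitive_set_def using Vrec_transitive[OF assms(1)] by blast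
  ultimately show ?thesis
    using assms(2) vrank_mono unfolding ranked_def opair_mem_restr[OF D] by blast
qed

section \<open>Elementary embeddings\<close>

locale embedding =
  fixes j :: "'v::zfc \<Rightarrow> 'v" and M :: "'v set"
  assumes elementary: "elementary_embedding j M"
begin

lemma inner_model: "inner_model M"
  using elementary unfolding elementary_embedding_def by blast

lemma transitive_M: "transitive_class M"
  using inner_model unfolding inner_model_def transitive_class_def by blast

lemma j_in_M: "j x \<in> M"
  using elementary unfolding elementary_embedding_def by blast

lemma Ord_in_M: "Ord \<alpha> \<Longrightarrow> \<alpha> \<in> M"
  using inner_model unfolding inner_model_def by blast

lemma mem_in_M: "x \<in> M \<Longrightarrow> y \<in>\<^sub>V x \<Longrightarrow> y \<in> M"
  using transitive_M unfolding transitive_class_def by blast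

lemma dfnt_j: "dfnt s \<Longrightarrow> dfnt (\<lambda>v. j (s v))"
proof (rule dfnt_comp1[where F=j])
  have "definable 2 {[x, j x] |x. True}"
    using elementary unfolding elementary_embedding_def by blast
  from definable_imp_dfn[OF this]
  have "dfn (\<lambda>v. v 1 = j (v 0))"
    by (simp add: numeral_2_eq_2)
  from dfn_reindex[OF this, of "\<lambda>i. if i = 0 then 1 else 0"]
  show "dfnt (\<lambda>v. j (v 0))" unfolding dfnt_def by simp
qed

lemma dfn_in_M: "dfnt s \<Longrightarrow> dfn (\<lambda>v. s v \<in> M)"
proof (rule dfn_comp1[where P="\<lambda>x. x \<in> M"])
  have "definable 1 {[x] |x. x \<in> M}" using inner_model unfolding inner_model_def by blast
  from definable_imp_dfn[OF this] show "dfn (\<lambda>v. v 0 \<in> M)" by simp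
qed

lemma transfer:
  assumes "expr Q"
  shows "Q UNIV v \<longleftrightarrow> Q M (j \<circ> v)"
proof -
  obtain \<phi> where \<phi>: "\<And>N v. transitive_class N \<Longrightarrow> range v \<subseteq> N \<Longrightarrow> sat N \<phi> v \<longleftrightarrow> Q N v"
    using exprE[OF assms] by metis
  have "sat UNIV \<phi> v \<longleftrightarrow> Q UNIV v" by (rule \<phi>) (simp_all add: transitive_class_def)
  moreover have "sat M \<phi> (j \<circ> v) \<longleftrightarrow> Q M (j \<circ> v)"
    by (rule \<phi>[OF transitive_M]) (auto simp: j_in_M)
  moreover have "sat UNIV \<phi> v \<longleftrightarrow> sat M \<phi> (j \<circ> v)"
    using elementary unfolding elementary_embedding_def by blast
  ultimately show ?thesis by simp
qed

lemma transfer2: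
  assumes "expr (\<lambda>N v. Q N (v 0) (v 1))"
  shows "Q UNIV a b \<longleftrightarrow> Q M (j a) (j b)"
  using transfer[OF assms, of "\<lambda>i. if i = 0 then a else b"] by simp

lemma j_mem: "j x \<in>\<^sub>V j y \<longleftrightarrow> x \<in>\<^sub>V y"
  using transfer2[where Q="\<lambda>N x y. x \<in>\<^sub>V y", OF expr_mem] by simp

lemma j_inject: "j x = j y \<longleftrightarrow> x = y"
  using transfer2[where Q="\<lambda>N x y. x = y", OF expr_eq] by simp

lemma j_Ord: "Ord (j \<alpha>) \<longleftrightarrow> Ord \<alpha>"
  using transfer2[where Q="\<lambda>N x y. Ord x", OF expr_Ord] by simp

lemma j_vsubset: "vsubset (j x) (j y) \<longleftrightarrow> vsubset x y"
proof -
  have "expr (\<lambda>N v. vsubset (v 0) (v 1))" unfolding vsubset_def by (intro expr_rules)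
  from transfer2[where Q="\<lambda>N. vsubset", OF this] show ?thesis by simp
qed

text \<open>
  M is closed under pairs and ranges because V is, and because this can be said with quantifiers over
  the universe in front of an absolute predicate.
\<close>

lemma opair_in_M:
  assumes "a \<in> M" "b \<in> M"
  shows "opair a b \<in> M"
proof -
  have "expr (\<lambda>N v. \<forall>a\<in>N. \<forall>b\<in>N. \<exists>p\<in>N. p = opair a (b :: 'v))"
    by (intro expr_rules expr_opair)
  from transfer[OF this] have "\<forall>a\<in>M. \<forall>b\<in>M. \<exists>p\<in>M. p = opair a b" by simp
  then show ?thesis using assms by blast
qed

lemma range_in_M:
  assumes "f \<in> M"
  shows "\<exists>r\<in>M. \<forall>y. y \<in>\<^sub>V r \<longleftrightarrow> (\<exists>a. opair a y \<in>\<^sub>V f)"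
proof -
  let ?snd = "\<lambda>p y. \<exists>u. u \<in>\<^sub>V p \<and> (\<exists>a. a \<in>\<^sub>V u \<and> p = opair a y)"
  let ?Q = "\<lambda>f r :: 'v. (\<forall>y. y \<in>\<^sub>V r \<longrightarrow> (\<exists>p. p \<in>\<^sub>V f \<and> ?snd p y)) \<and>
     (\<forall>p. p \<in>\<^sub>V f \<longrightarrow> (\<forall>u. u \<in>\<^sub>V p \<longrightarrow> (\<forall>y. y \<in>\<^sub>V u \<longrightarrow> ?snd p y \<longrightarrow> y \<in>\<^sub>V r)))"
  have snd: "?snd p y \<longleftrightarrow> (\<exists>a. p = opair a y)" for p y :: 'v
    unfolding opair_def by (metis mem_upair)
  have in_pair: "\<exists>u. u \<in>\<^sub>V opair a y \<and> y \<in>\<^sub>V u" for a y :: 'v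
    unfolding opair_def by (metis mem_upair)
  have Q: "?Q f r \<longleftrightarrow> (\<forall>y. y \<in>\<^sub>V r \<longleftrightarrow> (\<exists>a. opair a y \<in>\<^sub>V f))" for f r :: 'v
  proof
    assume Q: "?Q f r"
    show "\<forall>y. y \<in>\<^sub>V r \<longleftrightarrow> (\<exists>a. opair a y \<in>\<^sub>V f)"
    proof (intro allI iffI)
      fix y assume "y \<in>\<^sub>V r"
      then show "\<exists>a. opair a y \<in>\<^sub>V f" using Q unfolding snd by blast
    next
      fix y assume "\<exists>a. opair a y \<in>\<^sub>V f"
      then obtain a where a: "opair a y \<in>\<^sub>V f" by blast
      obtain u where "u \<in>\<^sub>V opair a y" "y \<in>\<^sub>V u" using in_pair by blast
      then show "y \<in>\<^sub>V r" using Q a unfolding snd by blast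
    qed
  next
    assume "\<forall>y. y \<in>\<^sub>V r \<longleftrightarrow> (\<exists>a. opair a y \<in>\<^sub>V f)"
    then show "?Q f r" unfolding snd by blast
  qed
  have "expr (\<lambda>N v. \<forall>f\<in>N. \<exists>r\<in>N. ?Q f (r :: 'v))" by (intro expr_rules expr_opair)
  from transfer[OF this] have *: "(\<forall>f. \<exists>r. ?Q f r) \<longleftrightarrow> (\<forall>f\<in>M. \<exists>r\<in>M. ?Q f r)" by simp
  have "\<exists>r. \<forall>y. y \<in>\<^sub>V r \<longleftrightarrow> (\<exists>a. opair a y \<in>\<^sub>V f)" for f :: 'v
  proof -
    have "small (\<lambda>y. \<exists>a. opair a y \<in>\<^sub>V f)"
      by (rule small_sep[where a="vUnion (vUnion f)"])
        (intro dfn_set_rules, use opair_mem_vUnion in blast)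
    then show ?thesis unfolding small_def .
  qed
  then show ?thesis using *[unfolded Q] assms by blast
qed

text \<open>
  The stage \<open>Vrec \<alpha>\<close> consists of the sets that have a certificate. Transferred by \<open>j\<close>, this says
  that \<open>j (Vrec \<alpha>)\<close> consists of the sets that have one in M.
\<close>

lemma mem_j_Vrec:
  assumes "Ord \<alpha>" "x \<in> M"
  shows "x \<in>\<^sub>V j (Vrec \<alpha>) \<longleftrightarrow> (\<exists>t\<in>M. \<exists>\<rho>\<in>M. ranked x (j \<alpha>) t \<rho>)"
proof -
  have "expr (\<lambda>N v. \<forall>x\<in>N. x \<in>\<^sub>V v 1 \<longleftrightarrow> (\<exists>t\<in>N. \<exists>\<rho>\<in>N. ranked x (v 0) t \<rho>))"
    by (intro expr_rules expr_ranked)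
  from transfer2[where Q="\<lambda>N a S. \<forall>x\<in>N. x \<in>\<^sub>V S \<longleftrightarrow> (\<exists>t\<in>N. \<exists>\<rho>\<in>N. ranked x a t \<rho>)", OF this]
  have "(\<forall>x. x \<in>\<^sub>V Vrec \<alpha> \<longleftrightarrow> (\<exists>t \<rho>. ranked x \<alpha> t \<rho>)) \<longleftrightarrow>
      (\<forall>x\<in>M. x \<in>\<^sub>V j (Vrec \<alpha>) \<longleftrightarrow> (\<exists>t\<in>M. \<exists>\<rho>\<in>M. ranked x (j \<alpha>) t \<rho>))" by simp
  moreover have "\<forall>x. x \<in>\<^sub>V Vrec \<alpha> \<longleftrightarrow> (\<exists>t \<rho>. ranked x \<alpha> t \<rho>)"
    using ranked_imp_mem_Vrec mem_Vrec_imp_ranked assms(1) by blast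
  ultimately show ?thesis using assms(2) by blast
qed

text \<open>
  By induction on \<open>\<beta>\<close>, \<open>j\<close> fixes the elements of \<open>x\<close>. The image \<open>j x\<close> gains no new ones: it is
  contained in \<open>j (Vrec \<beta>)\<close>, whose elements lie in the true \<open>Vrec \<beta>\<close> and so are fixed as well.
\<close>

lemma j_fixes_below:
  assumes "Ord \<kappa>" "\<And>\<alpha>. \<alpha> \<in>\<^sub>V \<kappa> \<Longrightarrow> j \<alpha> = \<alpha>" "\<beta> \<in>\<^sub>V \<kappa>" "vsubset x (Vrec \<beta>)"
  shows "j x = x"
proof -
  let ?P = "\<lambda>\<beta>. \<beta> \<in>\<^sub>V \<kappa> \<longrightarrow> (\<forall>x. vsubset x (Vrec \<beta>) \<longrightarrow> j x = x)"
  have "?P \<beta>"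
  proof (rule Ord_induct_dfn[where P="?P"])
    show "dfn (\<lambda>v. ?P (v 0))" by (intro dfn_set_rules dfnt_Vrec dfnt_j)
    show "Ord \<beta>" using Ord_mem[OF assms(1,3)] .
  next
    fix \<beta> assume "Ord \<beta>" and IH: "\<And>\<gamma>. \<gamma> \<in>\<^sub>V \<beta> \<Longrightarrow> ?P \<gamma>"
    show "?P \<beta>"
    proof (intro impI allI extensionality)
      fix x z assume \<beta>: "\<beta> \<in>\<^sub>V \<kappa>" and x: "vsubset x (Vrec \<beta>)"
      have fixed: "j y = y" if y: "y \<in>\<^sub>V Vrec \<beta>" for y
      proof -
        obtain \<gamma> where \<gamma>: "\<gamma> \<in>\<^sub>V \<beta>" "vsubset y (Vrec \<gamma>)" using y mem_Vrec[OF \<open>Ord \<beta>\<close>] by blast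
        moreover have "\<gamma> \<in>\<^sub>V \<kappa>" using Ord_trans[OF assms(1) \<beta> \<gamma>(1)] .
        ultimately show ?thesis using IH by blast
      qed
      show "z \<in>\<^sub>V j x \<longleftrightarrow> z \<in>\<^sub>V x"
      proof
        assume z: "z \<in>\<^sub>V j x"
        then have "z \<in> M" using mem_in_M j_in_M by blast
        moreover have "z \<in>\<^sub>V j (Vrec \<beta>)" using x z j_vsubset unfolding vsubset_def by blast
        ultimately have "z \<in>\<^sub>V Vrec \<beta>"
          using mem_j_Vrec[OF \<open>Ord \<beta>\<close>] assms(2)[OF \<beta>] ranked_imp_mem_Vrec[OF \<open>Ord \<beta>\<close>] by auto
        then show "z \<in>\<^sub>V x" using z fixed j_mem by metis
      next
        assume z: "z \<in>\<^sub>V x"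
        then have "j z = z" using fixed x unfolding vsubset_def by blast
        then show "z \<in>\<^sub>V j x" using z j_mem by metis
      qed
    qed
  qed
  then show ?thesis using assms(3,4) by blast
qed

end

locale closed_embedding = embedding j M for j :: "'v::zfc \<Rightarrow> 'v" and M +
  fixes \<mu> :: 'v
  assumes closed: "is_fun f \<mu> B \<Longrightarrow> (\<And>a b. opair a b \<in>\<^sub>V f \<Longrightarrow> b \<in> M) \<Longrightarrow> f \<in> M"
begin

text \<open>
  Apply \<open>k\<close> to the entries of \<open>e\<close> that lie in \<open>Y\<close>, and put a fixed element of \<open>Z\<close> at the other places.
  This sequence of length \<open>\<mu>\<close> is in M by closure, and \<open>Z\<close> is its range.
\<close>

lemma image_in_M:
  assumes e: "dfnt (\<lambda>v. e (v 0))" and Y: "\<And>y. y \<in>\<^sub>V Y \<Longrightarrow> \<exists>\<alpha>. \<alpha> \<in>\<^sub>V \<mu> \<and> y = e \<alpha>"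
    and k: "dfnt (\<lambda>v. k (v 0))" "\<And>y. y \<in>\<^sub>V Y \<Longrightarrow> k y \<in> M"
    and Z: "\<And>z. z \<in>\<^sub>V Z \<longleftrightarrow> (\<exists>y. y \<in>\<^sub>V Y \<and> z = k y)"
  shows "Z \<in> M"
proof (cases "\<exists>y. y \<in>\<^sub>V Y")
  case False
  then have "Ord Z" unfolding Ord_def transitive_set_def Z by blast
  then show ?thesis by (rule Ord_in_M)
next
  case True
  then obtain y0 where y0: "y0 \<in>\<^sub>V Y" by blast
  define h where "h \<alpha> = (if e \<alpha> \<in>\<^sub>V Y then k (e \<alpha>) else k y0)" for \<alpha>
  have h: "dfnt (\<lambda>v. h (v 0))"
    unfolding h_def by (intro dfn_set_rules dfnt_comp1[OF k(1)] dfnt_comp1[OF e])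
  have "h \<alpha> \<in>\<^sub>V Z" for \<alpha> unfolding h_def Z using y0 by auto
  then have "is_fun (restr h \<mu>) \<mu> Z" by (intro is_fun_restr h)
  moreover have "b \<in> M" if "opair a b \<in>\<^sub>V restr h \<mu>" for a b
    using that k(2) y0 unfolding opair_mem_restr[OF h] h_def by auto
  ultimately have "restr h \<mu> \<in> M" by (rule closed)
  then obtain r where r: "r \<in> M" "\<And>y. y \<in>\<^sub>V r \<longleftrightarrow> (\<exists>a. opair a y \<in>\<^sub>V restr h \<mu>)"
    using range_in_M by blast
  have "z \<in>\<^sub>V r \<longleftrightarrow> z \<in>\<^sub>V Z" for z
  proof
    assume "z \<in>\<^sub>V r"
    then show "z \<in>\<^sub>V Z" unfolding r(2) opair_mem_restr[OF h] using \<open>\<And>\<alpha>. h \<alpha> \<in>\<^sub>V Z\<close> by blast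
  next
    assume "z \<in>\<^sub>V Z"
    then obtain y where y: "y \<in>\<^sub>V Y" "z = k y" unfolding Z by blast
    obtain \<alpha> where "\<alpha> \<in>\<^sub>V \<mu>" "y = e \<alpha>" using Y[OF y(1)] by blast
    then show "z \<in>\<^sub>V r" unfolding r(2) opair_mem_restr[OF h] using y by (auto simp: h_def)
  qed
  then have "r = Z" by (rule extensionality)
  then show ?thesis using r(1) by simp
qed

text \<open>
  A minimal element of \<open>t\<close> outside M would be a subset of M that is enumerated by \<open>\<mu>\<close>, hence in M.
\<close>

lemma enumerated_transitive_set:
  assumes "transitive_set t" and e: "dfnt (\<lambda>v. e (v 0))"
    and t: "\<And>y. y \<in>\<^sub>V t \<Longrightarrow> \<exists>\<alpha>. \<alpha> \<in>\<^sub>V \<mu> \<and> y = e \<alpha>"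
  shows "t \<in> M" "\<And>y. y \<in>\<^sub>V t \<Longrightarrow> y \<in> M"
proof -
  have sub: "y \<in> M" if "vsubset y t" "\<And>z. z \<in>\<^sub>V y \<Longrightarrow> z \<in> M" for y
  proof (rule image_in_M[OF e, where Y=y and k="\<lambda>x. x"])
    show "\<exists>\<alpha>. \<alpha> \<in>\<^sub>V \<mu> \<and> z = e \<alpha>" if "z \<in>\<^sub>V y" for z
      using t that \<open>vsubset y t\<close> unfolding vsubset_def by blast
  qed (use that(2) dfnt_var in auto)
  show *: "y \<in> M" if y: "y \<in>\<^sub>V t" for y
  proof (rule ccontr)
    assume "y \<notin> M"
    moreover have "dfn (\<lambda>v. v 0 \<notin> M)" by (intro dfn_not dfn_in_M dfnt_var)
    ultimately obtain m where m: "m \<in>\<^sub>V t" "m \<notin> M" "\<And>z. z \<in>\<^sub>V t \<Longrightarrow> z \<notin> M \<Longrightarrow> \<not> z \<in>\<^sub>V m"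
      using ex_minimal[where P="\<lambda>x. x \<notin> M", OF _ y] by blast
    have "vsubset m t" using assms(1) m(1) unfolding transitive_set_def vsubset_def by blast
    then show False using sub[of m] m(2,3) unfolding vsubset_def by blast
  qed
  show "t \<in> M" by (rule sub) (use * in \<open>auto simp: vsubset_def\<close>)
qed

end

text \<open>
  Take \<open>\<mu>\<close> large enough to enumerate a transitive set \<open>t\<close> containing \<open>X\<close> and to bound its ranks.
  Closure under sequences of length \<open>\<mu>\<close> then puts \<open>t\<close>, its rank function and the restriction of \<open>j\<close>
  to \<open>X\<close> into \<open>M\<close>, and \<open>\<mu> < j \<kappa>\<close> makes the rank function certify that M sees \<open>X\<close> below \<open>j \<kappa>\<close>.
\<close>

theorem supercompact_embedding:
  assumes "supercompact \<kappa>"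
  shows "\<exists>j M. elementary_embedding j M \<and> (\<forall>\<alpha>. \<alpha> \<in>\<^sub>V \<kappa> \<longrightarrow> j \<alpha> = \<alpha>) \<and>
    X \<in> M \<and> restr j X \<in> M \<and> X \<in>\<^sub>V j (Vrec \<kappa>)"
proof -
  have "Ord \<kappa>" using assms unfolding supercompact_def Card_def by blast
  define \<delta> where "\<delta> = vsucc (vrank X)"
  define t where "t = Vrec \<delta>"
  have \<delta>: "Ord \<delta>" unfolding \<delta>_def by (intro Ord_vsucc vrank)
  have X: "X \<in>\<^sub>V t" unfolding t_def \<delta>_def mem_Vrec_vsucc[OF vrank(1)] by (rule vrank)
  have trans: "transitive_set t"
    using Vrec_transitive[OF \<delta>] unfolding transitive_set_def t_def by blast
  obtain \<alpha> e where \<alpha>: "Ord \<alpha>" and e: "dfnt (\<lambda>v. e (v 0))"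
    and enum: "\<And>y. y \<in>\<^sub>V t \<Longrightarrow> \<exists>\<beta>. \<beta> \<in>\<^sub>V \<alpha> \<and> y = e \<beta>" using well_ordering[of t] by blast
  \<comment> \<open>The larger of the two ordinals.\<close>
  obtain \<mu> where \<mu>: "Ord \<mu>" "vsubset \<alpha> \<mu>" "vsubset \<delta> \<mu>"
    using Ord_linear[OF \<alpha> \<delta>] Ord_trans[OF \<alpha>] Ord_trans[OF \<delta>] \<alpha> \<delta> unfolding vsubset_def by blast
  obtain j M where jM: "elementary_embedding j M" "\<And>\<alpha>. \<alpha> \<in>\<^sub>V \<kappa> \<Longrightarrow> j \<alpha> = \<alpha>" "\<mu> \<in>\<^sub>V j \<kappa>"
    "\<And>f B. is_fun f \<mu> B \<Longrightarrow> (\<And>a b. opair a b \<in>\<^sub>V f \<Longrightarrow> b \<in> M) \<Longrightarrow> f \<in> M"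
    using assms \<mu>(1) unfolding supercompact_def supercompact_for_def by blast
  interpret closed_embedding j M \<mu>
    by unfold_locales (use jM in blast)+
  have enum': "\<exists>\<beta>. \<beta> \<in>\<^sub>V \<mu> \<and> y = e \<beta>" if "y \<in>\<^sub>V t" for y
    using enum[OF that] \<mu>(2) unfolding vsubset_def by blast
  have tM: "t \<in> M" "\<And>y. y \<in>\<^sub>V t \<Longrightarrow> y \<in> M"
    using enumerated_transitive_set[OF trans e enum'] by blast+
  have "restr vrank t \<in> M"
  proof (rule image_in_M[OF e enum'])
    show "dfnt (\<lambda>v. opair (v 0) (vrank (v 0)))" by (intro dfn_set_rules dfnt_vrank)
    show "opair y (vrank y) \<in> M" if "y \<in>\<^sub>V t" for y
      using that by (intro opair_in_M tM(2) Ord_in_M vrank)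
  qed ((assumption | rule mem_restr[OF dfnt_vrank[OF dfnt_var]])+)
  moreover have "ranked X (j \<kappa>) t (restr vrank t)"
  proof (rule ranked_mono)
    show "ranked X \<delta> t (restr vrank t)"
      using mem_Vrec_imp_ranked[OF \<delta>] X unfolding t_def by blast
    show "vsubset \<delta> (j \<kappa>)"
      using \<mu>(3) jM(3) Ord_trans[OF j_Ord[THEN iffD2, OF \<open>Ord \<kappa>\<close>]] unfolding vsubset_def by blast
  qed
  ultimately have "X \<in>\<^sub>V j (Vrec \<kappa>)"
    using mem_j_Vrec[OF \<open>Ord \<kappa>\<close> tM(2)[OF X]] tM(1) by blast
  moreover have "restr j X \<in> M"
  proof (rule image_in_M[OF e])
    show "\<exists>\<beta>. \<beta> \<in>\<^sub>V \<mu> \<and> y = e \<beta>" if "y \<in>\<^sub>V X" for y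
      using that trans X enum' unfolding transitive_set_def by blast
    show "dfnt (\<lambda>v. opair (v 0) (j (v 0)))" by (intro dfn_set_rules dfnt_j)
    show "opair y (j y) \<in> M" if "y \<in>\<^sub>V X" for y
      using that mem_in_M[OF tM(2)[OF X]] by (intro opair_in_M j_in_M)
  qed (rule mem_restr[OF dfnt_j[OF dfnt_var]])
  ultimately show ?thesis using jM(1,2) tM(2)[OF X] by blast
qed

section \<open>Functions and morphisms\<close>

lemma small_vcomp:
  "small (\<lambda>p. \<exists>a b c. opair a b \<in>\<^sub>V f \<and> opair b c \<in>\<^sub>V g \<and> p = opair a (c :: 'v::zfc))"
proof (rule small_sep)
  show "dfn (\<lambda>v. \<exists>a b c. opair a b \<in>\<^sub>V f \<and> opair b c \<in>\<^sub>V g \<and> v 0 = opair a c)"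
    by (intro dfn_set_rules)
next
  \<comment> \<open>The composition is contained in a product, which is the union of its rows.\<close>
  define row where "row a = the_set (\<lambda>p. \<exists>c. c \<in>\<^sub>V vUnion (vUnion g) \<and> p = opair a c)" for a :: 'v
  have s: "small (\<lambda>p. \<exists>c. c \<in>\<^sub>V vUnion (vUnion g) \<and> p = opair a c)" for a :: 'v
    by (rule small_image) (intro dfn_set_rules)
  have row: "p \<in>\<^sub>V row a \<longleftrightarrow> (\<exists>c. c \<in>\<^sub>V vUnion (vUnion g) \<and> p = opair a c)" for p a
    unfolding row_def by (rule mem_the_set[OF s])
  have D: "dfnt (\<lambda>v. row (v 0))" unfolding row_def by (intro dfnt_the_set dfn_set_rules s)
  fix p assume "\<exists>a b c. opair a b \<in>\<^sub>V f \<and> opair b c \<in>\<^sub>V g \<and> p = opair a c"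
  then obtain a b c where p: "opair a b \<in>\<^sub>V f" "opair b c \<in>\<^sub>V g" "p = opair a c" by blast
  have "a \<in>\<^sub>V vUnion (vUnion f)" using p(1) unfolding mem_vUnion by (metis mem_upair opair_def)
  moreover have "p \<in>\<^sub>V row a" using opair_mem_vUnion[OF p(2)] p(3) row by blast
  ultimately show "p \<in>\<^sub>V the_set (\<lambda>p. \<exists>a. a \<in>\<^sub>V vUnion (vUnion f) \<and> p \<in>\<^sub>V row a)"
    unfolding mem_the_set[OF small_UN[OF D]] by blast
qed

lemma mem_vcomp:
  "p \<in>\<^sub>V g \<circ>\<^sub>V f \<longleftrightarrow> (\<exists>a b c. opair a b \<in>\<^sub>V f \<and> opair b c \<in>\<^sub>V g \<and> p = opair a c)"
  unfolding vcomp_def by (rule mem_the_set[OF small_vcomp])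

lemma opair_mem_vcomp: "opair a c \<in>\<^sub>V g \<circ>\<^sub>V f \<longleftrightarrow> (\<exists>b. opair a b \<in>\<^sub>V f \<and> opair b c \<in>\<^sub>V g)"
  unfolding mem_vcomp opair_inject by blast

lemma mem_vid: "p \<in>\<^sub>V vid A \<longleftrightarrow> (\<exists>a. a \<in>\<^sub>V A \<and> p = opair a a)"
  unfolding vid_def by (rule mem_the_set[OF small_image]) (intro dfn_set_rules dfnt_opair)

lemma vcomp_assoc: "h \<circ>\<^sub>V (g \<circ>\<^sub>V f) = (h \<circ>\<^sub>V g) \<circ>\<^sub>V f"
proof (rule extensionality)
  show "p \<in>\<^sub>V h \<circ>\<^sub>V (g \<circ>\<^sub>V f) \<longleftrightarrow> p \<in>\<^sub>V h \<circ>\<^sub>V g \<circ>\<^sub>V f" for p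
    unfolding mem_vcomp[of p] opair_mem_vcomp by blast
qed

lemma is_fun_opairE:
  assumes "is_fun f A B" "p \<in>\<^sub>V f"
  obtains a b where "a \<in>\<^sub>V A" "b \<in>\<^sub>V B" "p = opair a b"
  using assms unfolding is_fun_def by blast

lemma vcomp_vid:
  assumes "is_fun f A B"
  shows "f \<circ>\<^sub>V vid A = f" "vid B \<circ>\<^sub>V f = f"
proof -
  have pair: "\<exists>a b. a \<in>\<^sub>V A \<and> b \<in>\<^sub>V B \<and> p = opair a b" if "p \<in>\<^sub>V f" for p
    using assms that unfolding is_fun_def by blast
  have "p \<in>\<^sub>V f \<circ>\<^sub>V vid A \<longleftrightarrow> p \<in>\<^sub>V f" for p
    unfolding mem_vcomp mem_vid opair_inject using pair[of p] by blast
  then show "f \<circ>\<^sub>V vid A = f" by (rule extensionality)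
  have "p \<in>\<^sub>V vid B \<circ>\<^sub>V f \<longleftrightarrow> p \<in>\<^sub>V f" for p
    unfolding mem_vcomp mem_vid opair_inject
    using pair[of p] is_fun_opair_mem[OF assms] by blast
  then show "vid B \<circ>\<^sub>V f = f" by (rule extensionality)
qed

lemma vinj_imp_left_cancel:
  assumes f: "is_fun f A B" "vinj f A B" and u: "is_fun u Z A" and w: "is_fun w Z A"
    and eq: "f \<circ>\<^sub>V u = f \<circ>\<^sub>V w"
  shows "u = w"
proof -
  have sub: "p \<in>\<^sub>V w" if u: "is_fun u Z A" and w: "is_fun w Z A" and eq: "f \<circ>\<^sub>V u = f \<circ>\<^sub>V w"
    and p: "p \<in>\<^sub>V u" for u w p
  proof -
    obtain z a where za: "z \<in>\<^sub>V Z" "a \<in>\<^sub>V A" "p = opair z a" using is_fun_opairE[OF u p] .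
    obtain b where b: "opair a b \<in>\<^sub>V f" using f(1) za(2) unfolding is_fun_def by blast
    then have "opair z b \<in>\<^sub>V f \<circ>\<^sub>V w" using p za(3) eq[symmetric] opair_mem_vcomp by metis
    then obtain a' where a': "opair z a' \<in>\<^sub>V w" "opair a' b \<in>\<^sub>V f" unfolding opair_mem_vcomp by blast
    have "a' \<in>\<^sub>V A" "b \<in>\<^sub>V B" using is_fun_opair_mem w a'(1) f(1) b by blast+
    then have "a = a'" using f(2) za(2) b a'(2) unfolding vinj_def by blast
    then show ?thesis using a'(1) za(3) by simp
  qed
  show ?thesis by (rule extensionality) (use sub[OF u w eq] sub[OF w u eq[symmetric]] in blast)
qed

lemma is_fun_of_Hom: "concrete_category C \<Longrightarrow> Hom C A B f \<Longrightarrow> is_fun f A B"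
  unfolding concrete_category_def by blast

lemma Hom_vcomp: "concrete_category C \<Longrightarrow> Hom C A B f \<Longrightarrow> Hom C B D g \<Longrightarrow> Hom C A D (g \<circ>\<^sub>V f)"
  unfolding concrete_category_def by blast

text \<open>
  The extension of \<open>g\<close> along the unit of \<open>A\<close> is \<open>L g\<close> followed by the inverse of the unit of \<open>X\<close>. It
  is unique because the unit of \<open>A\<close> is an epimorphism.
\<close>

lemma local_imp_orthogonal:
  assumes C: "concrete_category C" and L: "extremal_epireflection C L"
    and X: "is_local C L X" and A: "Ob C A"
  shows "orthogonal C X A (Lobj L A) (unit L A)"
  unfolding orthogonal_def
proof (intro allI impI)
  fix g assume g: "Hom C A X g"
  have endo: "endofunctor C L" and nat: "unit_natural C L"
    using L unfolding extremal_epireflection_def reflection_def by blast+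
  have epi: "epimorphism C A (Lobj L A) (unit L A)"
    using L A unfolding extremal_epireflection_def extremal_epimorphism_def by blast
  obtain h where h: "Hom C (Lobj L X) X h" "h \<circ>\<^sub>V unit L X = vid X"
    using X unfolding is_local_def isomorphism_def by blast
  have Lg: "Hom C (Lobj L A) (Lobj L X) (Lmor L A X g)"
    using endo g unfolding endofunctor_def by blast
  have "(h \<circ>\<^sub>V Lmor L A X g) \<circ>\<^sub>V unit L A = h \<circ>\<^sub>V (unit L X \<circ>\<^sub>V g)"
    using nat g unfolding unit_natural_def by (simp add: vcomp_assoc[symmetric])
  also have "\<dots> = g"
    using vcomp_vid(2)[OF is_fun_of_Hom[OF C g]] by (simp add: vcomp_assoc h(2))
  finally have fac: "(h \<circ>\<^sub>V Lmor L A X g) \<circ>\<^sub>V unit L A = g" .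
  show "\<exists>!g'. Hom C (Lobj L A) X g' \<and> g' \<circ>\<^sub>V unit L A = g"
  proof (rule ex1I)
    show "Hom C (Lobj L A) X (h \<circ>\<^sub>V Lmor L A X g) \<and> (h \<circ>\<^sub>V Lmor L A X g) \<circ>\<^sub>V unit L A = g"
      using fac Hom_vcomp[OF C Lg h(1)] by blast
    fix k assume "Hom C (Lobj L A) X k \<and> k \<circ>\<^sub>V unit L A = g"
    then show "k = h \<circ>\<^sub>V Lmor L A X g"
      using epi fac Hom_vcomp[OF C Lg h(1)] unfolding epimorphism_def by metis
  qed
qed

text \<open>
  If \<open>f\<close> factors as \<open>g' \<circ> \<eta>\<close>, then the unit \<open>\<eta>\<close> is a monomorphism because \<open>f\<close> is. An extremal
  epimorphism that is also a monomorphism is an isomorphism.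
\<close>

lemma orthogonal_vinj_imp_local:
  assumes C: "concrete_category C" and L: "extremal_epireflection C L"
    and f: "Hom C A X f" "vinj f A X"
    and orth: "orthogonal C X A (Lobj L A) (unit L A)"
  shows "is_local C L A"
proof -
  have A: "Ob C A" using C f(1) unfolding concrete_category_def by blast
  obtain g where g: "g \<circ>\<^sub>V unit L A = f" using orth f(1) unfolding orthogonal_def by blast
  have ext: "extremal_epimorphism C A (Lobj L A) (unit L A)"
    using L A unfolding extremal_epireflection_def by blast
  then have \<eta>: "Hom C A (Lobj L A) (unit L A)"
    unfolding extremal_epimorphism_def epimorphism_def by blast
  have "monomorphism C A (Lobj L A) (unit L A)"
    unfolding monomorphism_def
  proof (intro conjI allI impI \<eta>)
    fix Z u w
    assume u: "Hom C Z A u" and w: "Hom C Z A w" and "unit L A \<circ>\<^sub>V u = unit L A \<circ>\<^sub>V w"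
    then have "f \<circ>\<^sub>V u = f \<circ>\<^sub>V w" by (simp add: g[symmetric] vcomp_assoc[symmetric])
    then show "u = w"
      using vinj_imp_left_cancel[OF is_fun_of_Hom[OF C f(1)] f(2)] is_fun_of_Hom[OF C] u w by blast
  qed
  moreover have "unit L A = unit L A \<circ>\<^sub>V vid A" using vcomp_vid(1)[OF is_fun_of_Hom[OF C \<eta>]] by simp
  moreover have "Hom C A A (vid A)" using C A unfolding concrete_category_def by blast
  ultimately have "isomorphism C A (Lobj L A) (unit L A)"
    using ext unfolding extremal_epimorphism_def by blast
  then show ?thesis using A unfolding is_local_def by blast
qed

text \<open>
  Terms denote total functions, so the partial class function \<open>F\<close> is extended by the identity.
\<close>

lemma dfnt_of_definable:
  assumes "definable 2 {[A, F A] |A. P A}" "dfn (\<lambda>v. P (v 0))"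
  shows "dfnt (\<lambda>v. if P (v 0) then F (v 0) else v 0)"
proof -
  have "dfn (\<lambda>v. v 1 = F (v 0) \<and> P (v 0))"
    using definable_imp_dfn[OF assms(1)] by (simp add: numeral_2_eq_2)
  from dfn_reindex[OF this, of "\<lambda>i. if i = 0 then 1 else 0"]
  have 1: "dfn (\<lambda>v. v 0 = F (v 1) \<and> P (v 1))" by simp
  from dfn_reindex[OF assms(2), of "\<lambda>i. 1"] have 2: "dfn (\<lambda>v. P (v 1))" .
  have "dfn (\<lambda>v. (v 0 = F (v 1) \<and> P (v 1)) \<or> (\<not> P (v 1) \<and> v 0 = v 1))"
    by (intro dfn_or dfn_and dfn_not 1 2 dfn_eq_var)
  then show ?thesis unfolding dfnt_def by (rule back_subst[where P=dfn]) (auto simp: fun_eq_iff)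
qed

lemma ex_set_of_units:
  assumes C: "concrete_category C" and L: "extremal_epireflection C L"
  shows "\<exists>F. \<forall>m. m \<in>\<^sub>V F \<longleftrightarrow> (\<exists>A. A \<in>\<^sub>V S \<and> Ob C A \<and> m = mor A (Lobj L A) (unit L A))"
proof -
  have "definable 1 {[A] |A. Ob C A}" using C unfolding concrete_category_def by blast
  from definable_imp_dfn[OF this] have Ob: "dfn (\<lambda>v. Ob C (v 0))" by simp
  have "endofunctor C L" "unit_natural C L"
    using L unfolding extremal_epireflection_def reflection_def by blast+
  then have "definable 2 {[A, Lobj L A] |A. Ob C A}" "definable 2 {[A, unit L A] |A. Ob C A}"
    unfolding endofunctor_def unit_natural_def by blast+
  note D = this[THEN dfnt_of_definable, OF Ob]
  define k where "k A = mor A (if Ob C A then Lobj L A else A) (if Ob C A then unit L A else A)" for A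
  have k: "dfnt (\<lambda>v. k (v 0))" unfolding k_def mor_def by (intro dfnt_opair dfnt_var D)
  have "small (\<lambda>A. A \<in>\<^sub>V S \<and> Ob C A)"
    by (rule small_sep[where a=S]) (intro dfn_set_rules dfn_comp1[OF Ob], simp)
  then obtain T where T: "\<And>A. A \<in>\<^sub>V T \<longleftrightarrow> A \<in>\<^sub>V S \<and> Ob C A" unfolding small_def by blast
  obtain F where F: "\<forall>m. m \<in>\<^sub>V F \<longleftrightarrow> (\<exists>A. A \<in>\<^sub>V T \<and> m = k A)"
    using small_image[OF k, of T] unfolding small_def by (elim exE)
  have "A \<in>\<^sub>V T \<and> m = k A \<longleftrightarrow> A \<in>\<^sub>V S \<and> Ob C A \<and> m = mor A (Lobj L A) (unit L A)" for A m
    unfolding T k_def by auto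
  then show ?thesis using F by (intro exI[of _ F]) simp
qed

section \<open>Reflection at a supercompact cardinal\<close>

lemma absoluteD:
  assumes "absolute \<phi> n ps" "inner_model M" "set ps \<subseteq> M" "length xs = n" "set xs \<subseteq> M"
  shows "holds M \<phi> (xs @ ps) \<longleftrightarrow> holds UNIV \<phi> (xs @ ps)"
  using assms unfolding absolute_def by blast

text \<open>
  That some \<open>A\<close> of rank below \<open>\<kappa>\<close> and outside the class of \<open>\<psi>\<close> embeds into \<open>X\<close> is obtained by
  pulling back along \<open>j\<close> the same assertion about \<open>j \<kappa>\<close> and \<open>j X\<close> in M. There \<open>X\<close> itself and the
  restriction of \<open>j\<close> are witnesses: \<open>X\<close> has rank below \<open>j \<kappa>\<close> in M, and by absoluteness M agrees
  with V about the category and about \<open>\<psi>\<close>. The parameters stay the same since \<open>j\<close> fixes them.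
\<close>

theorem supercompact_reflection:
  fixes C :: "'v::zfc ccat"
  assumes C: "absolute_category_by C \<phi> ps" "supports_elementary_embeddings C"
    and \<psi>: "absolute \<psi> 1 qs"
    and \<kappa>: "supercompact \<kappa>" "\<And>a. a \<in> set ps \<union> set qs \<Longrightarrow> rank a \<in>\<^sub>V \<kappa>"
    and X: "Ob C X" "\<not> holds UNIV \<psi> ([X] @ qs)"
  shows "\<exists>A f. A \<in>\<^sub>V Vrec \<kappa> \<and> Hom C A X f \<and> vinj f A X \<and> \<not> holds UNIV \<psi> ([A] @ qs)"
proof -
  have \<phi>: "absolute \<phi> 3 ps"
    and hom: "\<And>A B f. is_fun f A B \<Longrightarrow>
      holds UNIV \<phi> ([A, B, f] @ ps) \<longleftrightarrow> Ob C A \<and> Ob C B \<and> Hom C A B f"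
    using C(1) unfolding absolute_category_by_def by blast+
  have "Ord \<kappa>" using \<kappa>(1) unfolding supercompact_def Card_def by blast
  obtain j M where j: "elementary_embedding j M" and crit: "\<And>\<alpha>. \<alpha> \<in>\<^sub>V \<kappa> \<Longrightarrow> j \<alpha> = \<alpha>"
    and XM: "X \<in> M" "restr j X \<in> M" "X \<in>\<^sub>V j (Vrec \<kappa>)"
    using supercompact_embedding[OF \<kappa>(1), of X] by blast
  interpret embedding j M by unfold_locales (rule j)
  have params: "j a = a" if "a \<in> set ps \<union> set qs" for a
    using j_fixes_below[OF \<open>Ord \<kappa>\<close> crit _ vrank(2)] \<kappa>(2)[OF that] unfolding rank_eq_vrank by blast
  then have params_M: "set ps \<subseteq> M" "set qs \<subseteq> M" using j_in_M by (metis UnCI subsetI)+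

  \<comment> \<open>In the formula, variables 0, 1, 2, 3 stand for \<open>f\<close>, \<open>A\<close>, the bound on \<open>A\<close>, and \<open>X\<close>; the later
    ones carry both lists of parameters.\<close>
  define r where "r i = (if i = 0 then 1 else if i = 1 then 3 else if i = 2 then 0
      else Suc (Suc (Suc (Suc (2 * (i - 3))))))" for i :: nat
  define s where "s i = (if i = 0 then 1 else Suc (Suc (Suc (Suc (Suc (2 * (i - 1)))))))" for i :: nat
  define R where "R N u \<longleftrightarrow> u 1 \<in>\<^sub>V u 2 \<and> is_fun (u 0) (u 1) (u 3) \<and> vinj (u 0) (u 1) (u 3) \<and>
      sat N \<phi> (\<lambda>i. u (r i)) \<and> \<not> sat N \<psi> (\<lambda>i. u (s i))" for N and u :: "nat \<Rightarrow> 'v"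
  define env where "env S Y p q = case_nat S (case_nat Y (interleave p q))"
    for S Y :: 'v and p q :: "nat \<Rightarrow> 'v"
  have R: "R N (case_nat f (case_nat A (env S Y p q))) \<longleftrightarrow>
      A \<in>\<^sub>V S \<and> is_fun f A Y \<and> vinj f A Y \<and> holds N \<phi> ([A, Y, f] @ ps) \<and> \<not> holds N \<psi> ([A] @ qs)"
    if p: "\<And>i. i < length ps \<Longrightarrow> p i = ps ! i" and q: "\<And>i. i < length qs \<Longrightarrow> q i = qs ! i"
    for N f A S Y p q
  proof -
    let ?u = "case_nat f (case_nat A (env S Y p q))"
    have u: "?u 0 = f" "?u 1 = A" "?u 2 = S" "?u 3 = Y"
      "\<And>n. ?u (Suc (Suc (Suc (Suc n)))) = interleave p q n"
      by (simp_all add: env_def numeral_2_eq_2 numeral_3_eq_3)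
    have params: "interleave p q (2 * k) = p k" "interleave p q (Suc (2 * k)) = q k" for k
      by (simp_all add: interleave_def)
    have rs: "r 0 = 1" "r 1 = 3" "r 2 = 0" "r (Suc (Suc (Suc k))) = Suc (Suc (Suc (Suc (2 * k))))"
      "s 0 = 1" "s (Suc k) = Suc (Suc (Suc (Suc (Suc (2 * k)))))" for k
      by (simp_all add: r_def s_def)
    have "sat N \<phi> (\<lambda>i. ?u (r i)) \<longleftrightarrow> sat N \<phi> (\<lambda>i. ([A, Y, f] @ ps) ! i)"
    proof (rule sat_cong)
      fix i assume "i \<in> fv \<phi>"
      then have "i < 3 + length ps" using \<phi> unfolding absolute_def by auto
      then have "i = 0 \<or> i = 1 \<or> i = 2 \<or> (\<exists>k. i = Suc (Suc (Suc k)) \<and> k < length ps)" by presburger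
      then show "?u (r i) = ([A, Y, f] @ ps) ! i"
        by (elim disjE exE conjE) (simp_all only: rs u params p, simp_all add: p)
    qed
    moreover have "sat N \<psi> (\<lambda>i. ?u (s i)) \<longleftrightarrow> sat N \<psi> (\<lambda>i. ([A] @ qs) ! i)"
    proof (rule sat_cong)
      fix i assume "i \<in> fv \<psi>"
      then have "i < 1 + length qs" using \<psi> unfolding absolute_def by auto
      then have "i = 0 \<or> (\<exists>k. i = Suc k \<and> k < length qs)" by presburger
      then show "?u (s i) = ([A] @ qs) ! i"
        by (elim disjE exE conjE) (simp_all only: rs u params q, simp_all add: q)
    qed
    ultimately show ?thesis
      unfolding R_def holds_def u by simp
  qed
  have "expr R" unfolding R_def by (intro expr_rules expr_is_fun expr_vinj expr_sat)
  then have "expr (\<lambda>N v. \<exists>A\<in>N. \<exists>f\<in>N. R N (case_nat f (case_nat A v)))"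
    by (intro expr_ex_env[where Q="\<lambda>N v. \<exists>f\<in>N. R N (case_nat f v)"] expr_ex_env[where Q=R])
  from transfer[OF this, of "env (Vrec \<kappa>) X ((!) ps) ((!) qs)"]
  have "(\<exists>A f. R UNIV (case_nat f (case_nat A (env (Vrec \<kappa>) X ((!) ps) ((!) qs))))) \<longleftrightarrow>
      (\<exists>A\<in>M. \<exists>f\<in>M. R M (case_nat f (case_nat A (j \<circ> env (Vrec \<kappa>) X ((!) ps) ((!) qs)))))"
    by simp
  moreover have "j \<circ> env (Vrec \<kappa>) X ((!) ps) ((!) qs) =
      env (j (Vrec \<kappa>)) (j X) (j \<circ> (!) ps) (j \<circ> (!) qs)"
    unfolding env_def by (rule ext) (auto simp: interleave_def split: nat.split)
  moreover have "R M (case_nat (restr j X) (case_nat X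
      (env (j (Vrec \<kappa>)) (j X) (j \<circ> (!) ps) (j \<circ> (!) qs))))"
  proof (subst R)
    note D = dfnt_j[OF dfnt_var, of 0]
    have f: "is_fun (restr j X) X (j X)" by (intro is_fun_restr D) (simp add: j_mem)
    have "vinj (restr j X) X (j X)"
      unfolding vinj_def opair_mem_restr[OF D] by (auto simp: j_inject)
    moreover have "Hom C X (j X) (restr j X)"
      using C(2) j X(1) unfolding supports_elementary_embeddings_def by blast
    then have "holds UNIV \<phi> ([X, j X, restr j X] @ ps)"
      using hom[OF f] C(1) unfolding absolute_category_by_def concrete_category_def by blast
    then have "holds M \<phi> ([X, j X, restr j X] @ ps)"
      using absoluteD[OF \<phi> inner_model params_M(1), of "[X, j X, restr j X]"] XM j_in_M[of X] by simp
    moreover have "\<not> holds M \<psi> ([X] @ qs)"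
      using absoluteD[OF \<psi> inner_model params_M(2), of "[X]"] XM(1) X(2) by simp
    ultimately show "X \<in>\<^sub>V j (Vrec \<kappa>) \<and> is_fun (restr j X) X (j X) \<and> vinj (restr j X) X (j X) \<and>
        holds M \<phi> ([X, j X, restr j X] @ ps) \<and> \<not> holds M \<psi> ([X] @ qs)"
      using f XM(3) by blast
  qed (simp_all add: params)
  ultimately obtain A f where "R UNIV (case_nat f (case_nat A (env (Vrec \<kappa>) X ((!) ps) ((!) qs))))"
    using XM(1,2) by auto
  then have "A \<in>\<^sub>V Vrec \<kappa> \<and> is_fun f A X \<and> vinj f A X \<and>
      holds UNIV \<phi> ([A, X, f] @ ps) \<and> \<not> holds UNIV \<psi> ([A] @ qs)"
    by (subst (asm) R) simp_all
  then show ?thesis using hom by blast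
qed

theorem corollary4p6:
  fixes C :: "'v::zfc ccat"
    and L :: "'v refl_data"
    and \<phi> \<psi> :: fm
    and ps qs :: "'v list"
    and \<kappa> :: 'v
  assumes "absolute_category_by C \<phi> ps"
    and "supports_elementary_embeddings C"
    and "extremal_epireflection C L"
    and "absolute_reflection_by C L \<psi> qs"
    and "supercompact \<kappa>"
    and "\<forall>a \<in> set ps \<union> set qs. rank a \<in>\<^sub>V \<kappa>"
  shows "\<exists>F. set_of_morphisms C F \<and> is_localization C L F"
proof -
  have C: "concrete_category C" using assms(1) unfolding absolute_category_by_def by blast
  have \<psi>: "absolute \<psi> 1 qs" "\<And>X. holds UNIV \<psi> ([X] @ qs) \<longleftrightarrow> is_local C L X"
    using assms(4) unfolding absolute_reflection_by_def by blast+
  obtain F where F: "\<And>m. m \<in>\<^sub>V F \<longleftrightarrow>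
      (\<exists>A. A \<in>\<^sub>V Vrec \<kappa> \<and> Ob C A \<and> m = mor A (Lobj L A) (unit L A))"
    using ex_set_of_units[OF C assms(3), of "Vrec \<kappa>"] by blast
  have "Hom C A (Lobj L A) (unit L A)" if "Ob C A" for A
    using assms(3) that unfolding extremal_epireflection_def reflection_def unit_natural_def by blast
  then have "set_of_morphisms C F" unfolding set_of_morphisms_def F by blast
  moreover have "is_localization C L F"
    unfolding is_localization_def
  proof (intro allI impI iffI)
    fix X A B f assume "is_local C L X" "mor A B f \<in>\<^sub>V F"
    then show "orthogonal C X A B f"
      using local_imp_orthogonal[OF C assms(3)] unfolding F mor_def opair_inject by blast
  next
    fix X assume X: "Ob C X" and orth: "\<forall>A B f. mor A B f \<in>\<^sub>V F \<longrightarrow> orthogonal C X A B f"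
    show "is_local C L X"
    proof (rule ccontr)
      assume "\<not> is_local C L X"
      then obtain A f where A: "A \<in>\<^sub>V Vrec \<kappa>" "\<not> is_local C L A"
        and f: "Hom C A X f" "vinj f A X"
        using supercompact_reflection[OF assms(1,2) \<psi>(1) assms(5) _ X] assms(6) \<psi>(2) by blast
      have "Ob C A" using C f(1) unfolding concrete_category_def by blast
      then have "orthogonal C X A (Lobj L A) (unit L A)" using orth A(1) F by blast
      then show False using orthogonal_vinj_imp_local[OF C assms(3) f] A(2) by blast
    qed
  qed
  ultimately show ?thesis by blast
qed

end
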